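(* Let $N\ge 2$ be an integer, $a=1$, $b>0$, $m>0$, $h>0$ and $0\le\theta<2\pi/N$. If the configuration formed by two twisted regular $N$-gons with parameters $(N,1,b,m,h,\theta)$ is a central configuration, then $b=1$ and $\theta\in\{0,\pi/N\}$. Moreover, for each $\theta\in\{0,\pi/N\}$ there exists a unique $h>0$ such that the configuration with parameters $(N,1,1,m,h,\theta)$ is a central configuration. In other words, there are exactly two spatial central configurations formed by parallel regular $N$-gons of the same size.
   Context: Identify $\mathbb{R}^3$ with $\mathbb{C}\times\mathbb{R}$. For $1\le k\le N$ let $\theta_k=2k\pi/N$, $\rho_k=e^{i\theta_k}$ and $\tilde\rho_k=a\rho_k e^{i\theta}$. The configuration formed by two twisted regular $N$-gons with parameters $(N,a,b,m,h,\theta)$ consists of $2N$ point masses: a mass $m$ at each point $q_k=(\rho_k,0)$ and a mass $bm$ at each point $\tilde q_k=(\tilde\rho_k,h)$, $1\le k\le N$. Here $h$ is the distance between the two layers and $\theta$ is the twisted angle. By the rotational symmetry of the polygons, $\theta$ matters only modulo $2\pi/N$. Central configuration: point masses $\mu_1,\dots,\mu_n>0$ at positions $x_1,\dots,x_n\in\mathbb{R}^3$ form a central configuration if the positions are pairwise distinct and, with $z_0=\left(\sum_j \mu_j x_j\right)/\left(\sum_j\mu_j\right)$ the center of mass and $y_k=x_k-z_0$, there is $\lambda\in\mathbb{R}$ such that $\sum_{j\ne k}\frac{\mu_j\mu_k}{|y_j-y_k|^3}(y_j-y_k)=-\lambda\mu_k y_k$ for all $1\le k\le n$.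
   Formalization: For N=2, h=√2, θ=π/2 (a regular tetrahedron, central for every b>0) the claim b=1 fails, so that case is excluded from the first assertion; "exactly two" counts the pairs (h,θ) that are central for some b>0. *)

theory Defs
  imports "HOL-Analysis.Analysis"
begin

text \<open>Euclidean space is \<open>complex \<times> real\<close>, whose product norm is the Euclidean one.\<close>

definition center_of_mass :: "'i set \<Rightarrow> ('i \<Rightarrow> real) \<Rightarrow> ('i \<Rightarrow> complex \<times> real) \<Rightarrow> complex \<times> real"
  where "center_of_mass I \<mu> x = (1 / (\<Sum>j\<in>I. \<mu> j)) *\<^sub>R (\<Sum>j\<in>I. \<mu> j *\<^sub>R x j)"

definition central_configuration :: "'i set \<Rightarrow> ('i \<Rightarrow> real) \<Rightarrow> ('i \<Rightarrow> complex \<times> real) \<Rightarrow> bool"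
  where "central_configuration I \<mu> x \<longleftrightarrow>
    finite I \<and> (\<forall>i\<in>I. 0 < \<mu> i) \<and> inj_on x I \<and>
    (let y = (\<lambda>k. x k - center_of_mass I \<mu> x) in
      \<exists>c. \<forall>k\<in>I. (\<Sum>j\<in>I - {k}. (\<mu> j * \<mu> k / norm (y j - y k) ^ 3) *\<^sub>R (y j - y k))
                  = - (c * \<mu> k) *\<^sub>R y k)"

text \<open>\<open>Inl k\<close> indexes the vertices of the first polygon, \<open>Inr k\<close> those of the second.\<close>

definition two_ngons_index :: "nat \<Rightarrow> (nat + nat) set"
  where "two_ngons_index N = {1..N} <+> {1..N}"

definition two_ngons_mass :: "real \<Rightarrow> real \<Rightarrow> nat + nat \<Rightarrow> real"
  where "two_ngons_mass b m = case_sum (\<lambda>_. m) (\<lambda>_. b * m)"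

definition two_ngons_position :: "nat \<Rightarrow> real \<Rightarrow> real \<Rightarrow> real \<Rightarrow> nat + nat \<Rightarrow> complex \<times> real"
  where "two_ngons_position N a h \<theta> =
    case_sum (\<lambda>k. (cis (2 * real k * pi / real N), 0))
             (\<lambda>k. (of_real a * cis (2 * real k * pi / real N) * cis \<theta>, h))"

definition two_ngons_central ::
    "nat \<Rightarrow> real \<Rightarrow> real \<Rightarrow> real \<Rightarrow> real \<Rightarrow> real \<Rightarrow> bool"
  where "two_ngons_central N a b m h \<theta> \<longleftrightarrow>
    central_configuration (two_ngons_index N) (two_ngons_mass b m) (two_ngons_position N a h \<theta>)"

text \<open>
  Mutually equidistant points form a central configuration for arbitrary positive masses. For
  \<open>N = 2\<close>, \<open>a = 1\<close>, \<open>h = sqrt 2\<close>, \<open>\<theta> = pi / 2\<close> the four bodies are the vertices of a regular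
  tetrahedron, so there the mass ratio \<open>b\<close> is not determined.
\<close>

lemma central_configuration_equidistant:
  assumes fin: "finite I" and pos: "\<And>i. i \<in> I \<Longrightarrow> 0 < \<mu> i" and "0 < d"
    and dist: "\<And>i j. i \<in> I \<Longrightarrow> j \<in> I \<Longrightarrow> i \<noteq> j \<Longrightarrow> norm (x i - x j) = d"
  shows "central_configuration I \<mu> x"
proof -
  define M where "M = (\<Sum>j\<in>I. \<mu> j)"
  define z where "z = center_of_mass I \<mu> x"
  have inj: "inj_on x I"
  proof (rule inj_onI, rule ccontr)
    fix i j assume "i \<in> I" "j \<in> I" "x i = x j" "i \<noteq> j"
    then show False using dist[of i j] \<open>0 < d\<close> by simp
  qed
  have "(\<Sum>j\<in>I - {k}. (\<mu> j * \<mu> k / norm (x j - x k) ^ 3) *\<^sub>R (x j - x k))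
      = - (M / d ^ 3 * \<mu> k) *\<^sub>R (x k - z)" if k: "k \<in> I" for k
  proof -
    have M: "M \<noteq> 0"
      using sum_pos[of I \<mu>] fin pos k unfolding M_def by fastforce
    have Mz: "M *\<^sub>R z = (\<Sum>j\<in>I. \<mu> j *\<^sub>R x j)"
      using M unfolding z_def center_of_mass_def M_def[symmetric] by simp
    have "(\<Sum>j\<in>I - {k}. (\<mu> j * \<mu> k / norm (x j - x k) ^ 3) *\<^sub>R (x j - x k))
        = (\<Sum>j\<in>I - {k}. (\<mu> j * \<mu> k / d ^ 3) *\<^sub>R (x j - x k))"
      using dist k by (intro sum.cong) auto
    also have "\<dots> = (\<Sum>j\<in>I. (\<mu> j * \<mu> k / d ^ 3) *\<^sub>R (x j - x k))"
      using fin k by (simp add: sum.remove)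
    also have "\<dots> = (\<Sum>j\<in>I. (\<mu> k / d ^ 3) *\<^sub>R (\<mu> j *\<^sub>R x j - \<mu> j *\<^sub>R x k))"
      by (intro sum.cong) (simp_all add: scaleR_right_diff_distrib mult.commute)
    also have "\<dots> = (\<mu> k / d ^ 3) *\<^sub>R (M *\<^sub>R z - M *\<^sub>R x k)"
      unfolding Mz by (simp add: scaleR_sum_right[symmetric] sum_subtractf M_def scaleR_sum_left)
    also have "\<dots> = - (M / d ^ 3 * \<mu> k) *\<^sub>R (x k - z)"
      by (simp add: scaleR_right_diff_distrib mult.commute)
    finally show ?thesis .
  qed
  then show ?thesis
    using fin pos inj unfolding central_configuration_def Let_def z_def[symmetric]
    by (auto intro!: exI[of _ "M / d ^ 3"])
qed

lemma two_ngons_central_tetrahedron: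
  assumes "0 < b" "0 < m"
  shows "two_ngons_central 2 1 b m (sqrt 2) (pi / 2)"
proof -
  have I: "two_ngons_index 2 = {Inl 1, Inl 2, Inr 1, Inr 2}"
    by (auto simp: two_ngons_index_def Plus_def numeral_2_eq_2 atLeastAtMostSuc_conv)
  have x: "two_ngons_position 2 1 (sqrt 2) (pi / 2) (Inl 1) = (-1, 0)"
    "two_ngons_position 2 1 (sqrt 2) (pi / 2) (Inl 2) = (1, 0)"
    "two_ngons_position 2 1 (sqrt 2) (pi / 2) (Inr 1) = (- \<i>, sqrt 2)"
    "two_ngons_position 2 1 (sqrt 2) (pi / 2) (Inr 2) = (\<i>, sqrt 2)"
    by (simp_all add: two_ngons_position_def)
  have "norm (two_ngons_position 2 1 (sqrt 2) (pi / 2) i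
      - two_ngons_position 2 1 (sqrt 2) (pi / 2) j) = 2"
    if "i \<in> two_ngons_index 2" "j \<in> two_ngons_index 2" "i \<noteq> j" for i j
    using that unfolding I by (auto simp: x x[simplified] norm_Pair cmod_def)
  then show ?thesis
    unfolding two_ngons_central_def
    by (intro central_configuration_equidistant[where d = 2])
      (auto simp: two_ngons_index_def two_ngons_mass_def assms)
qed

end

theory Submission
  imports Defs "HOL-Real_Asymp.Real_Asymp"
begin

text \<open>
  Write \<open>W\<close> for the \<open>N\<close>-th roots of unity, \<open>u = cis \<theta>\<close>, and
  \<open>d z = sqrt (2 + h\<^sup>2 - 2 * Re z) ^ 3\<close> for the cubed distance of points of different layers. With
  \<open>S = (\<Sum>w\<in>W. 1 / d (w * u))\<close>, \<open>T = (\<Sum>w\<in>W. w * u / d (w * u))\<close> and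
  \<open>P = (\<Sum>w\<in>W - {1}. 1 / (2 * cmod (1 - w)))\<close>, rotational symmetry leaves one equation per layer.
  Its vertical component fixes the multiplier, and the planar ones become \<open>P = S + b * T\<close> and
  \<open>b * P = b * S + cnj T\<close>. Hence \<open>T\<close> is real, and \<open>b = 1\<close> or \<open>T = 0\<close>.

  The sign of \<open>Im T\<close> is that of \<open>sin (N * \<theta>)\<close>: since
  \<open>pi / 4 / y powr (3/2)\<close> is the integral of \<open>1 / (y + v\<^sup>2)\<^sup>2\<close> over \<open>v > 0\<close>, it suffices to treat the
  kernel \<open>1 / (R - 2 * Re z)\<^sup>2\<close>, and there the sum over \<open>W\<close> is explicit, by differentiating the imaginary
  part of \<open>(\<Sum>w\<in>W. 1 / (1 - t * w * u)) = N / (1 - t ^ N * u ^ N)\<close> in \<open>t\<close>, where \<open>R = t + 1 / t\<close>.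
  So \<open>\<theta>\<close> is \<open>0\<close> or \<open>pi / N\<close>.

  Since \<open>\<Sum>w\<in>W. Re (w * u) = 0\<close> and \<open>1 / d z\<close> increases with \<open>Re z\<close>, Chebyshev's argument gives
  \<open>Re T \<ge> 0\<close>, with equality only if all \<open>Re (w * u)\<close> vanish, which is the tetrahedron. For \<open>b = 1\<close>, the
  sum \<open>S + Re T\<close> of the terms \<open>(1 + Re (w * u)) / d (w * u)\<close> decreases strictly in \<open>h\<close> to \<open>0\<close>, and it
  exceeds \<open>P\<close> for small \<open>h\<close>; for \<open>\<theta> = pi / N\<close> the single term \<open>w = 1\<close> at \<open>h = 0\<close> suffices.
\<close>

subsection \<open>Sums over roots of unity\<close>

abbreviation roots_unity :: "nat \<Rightarrow> complex set"
  where "roots_unity N \<equiv> {z. z ^ N = 1}"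

lemma norm_root_unity:
  assumes "w \<in> roots_unity N" "0 < N"
  shows "cmod w = 1"
proof -
  have "cmod w ^ N = 1 ^ N" using assms(1) by (simp flip: norm_power)
  then show ?thesis by (rule power_eq_imp_eq_base) (use assms(2) in simp_all)
qed

lemma cis_root_unity:
  assumes "0 < N"
  shows "cis (2 * real k * pi / real N) \<in> roots_unity N"
proof -
  have "real N * (2 * real k * pi / real N) = 2 * pi * real k" using assms by simp
  then show ?thesis by (simp only: mem_Collect_eq Complex.DeMoivre) (simp add: cis_multiple_2pi)
qed

text \<open>The standard enumeration of the roots starts at index 0, whereas the vertices are
  numbered from 1; indices 0 and \<open>N\<close> give the same root. Injectivity follows by
  counting.\<close>

lemma bij_betw_roots_unity_cis:
  assumes "0 < N"
  shows "bij_betw (\<lambda>k. cis (2 * real k * pi / real N)) {1..N} (roots_unity N)"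
proof -
  let ?f = "\<lambda>k::nat. cis (2 * real k * pi / real N)"
  have b: "bij_betw ?f {..<N} (roots_unity N)"
    using Complex.bij_betw_roots_unity[OF assms] by (simp add: mult.commute mult.left_commute)
  have f: "?f N = ?f 0" using assms by simp
  have eq: "{..<N} = insert 0 {1..<N}" "{1..N} = insert N {1..<N}" using assms by auto
  have "?f ` {1..N} = roots_unity N"
    using bij_betw_imp_surj_on[OF b] f unfolding eq by simp
  moreover have "card (?f ` {1..N}) = card {1..N}"
    unfolding \<open>?f ` {1..N} = roots_unity N\<close> using card_roots_unity_eq[OF assms] by simp
  ultimately show ?thesis by (simp add: bij_betw_def eq_card_imp_inj_on)
qed

lemma bij_betw_mult_root_unity:
  assumes "\<rho> \<in> roots_unity N" "0 < N"
  shows "bij_betw (\<lambda>w. \<rho> * w) (roots_unity N) (roots_unity N)"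
proof (rule bij_betw_byWitness[where f' = "\<lambda>w. w / \<rho>"])
  have "\<rho> \<noteq> 0" using assms by (auto simp: power_0_left)
  then show "\<forall>w\<in>roots_unity N. \<rho> * w / \<rho> = w" "\<forall>w\<in>roots_unity N. \<rho> * (w / \<rho>) = w" by auto
qed (use assms in \<open>auto simp: power_mult_distrib power_divide\<close>)

lemma bij_betw_cnj_roots_unity: "bij_betw cnj (roots_unity N) (roots_unity N)"
  by (rule bij_betw_byWitness[where f' = cnj]) (auto simp flip: complex_cnj_power)

text \<open>Multiplication by the primitive root \<open>\<zeta>\<close> permutes the roots, so the
  sum equals \<open>\<zeta> ^ k\<close> times itself, and \<open>\<zeta> ^ k\<close> differs from
  1.\<close>

lemma sum_power_roots_unity:
  assumes "0 < k" "k < N"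
  shows "(\<Sum>w\<in>roots_unity N. w ^ k) = 0"
proof -
  define \<zeta> where "\<zeta> = cis (2 * real (1::nat) * pi / real N)"
  have N: "0 < N" using assms by simp
  have \<zeta>: "\<zeta> \<in> roots_unity N" unfolding \<zeta>_def by (rule cis_root_unity[OF N])
  have "\<zeta> ^ k \<noteq> 1"
  proof
    assume "\<zeta> ^ k = 1"
    then have "cis (2 * pi * real k / real N) = cis (2 * pi * real 0 / real N)"
      unfolding \<zeta>_def Complex.DeMoivre by (simp add: mult_ac)
    then show False
      using Complex.bij_betw_roots_unity[OF N] assms inj_onD[of _ "{..<N}" k 0]
      unfolding bij_betw_def by (metis (no_types, lifting) lessThan_iff less_numeral_extra(3) N)
  qed
  moreover have "\<zeta> ^ k * (\<Sum>w\<in>roots_unity N. w ^ k) = (\<Sum>w\<in>roots_unity N. w ^ k)"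
    using sum.reindex_bij_betw[OF bij_betw_mult_root_unity[OF \<zeta> N], of "\<lambda>w. w ^ k"]
    by (simp add: sum_distrib_left power_mult_distrib)
  ultimately show ?thesis by simp
qed

text \<open>Since \<open>(w * z) ^ N = z ^ N\<close>, a finite geometric sum brings every term over
  the common denominator \<open>1 - z ^ N\<close>. Summing over \<open>w\<close> then kills all
  powers except the zeroth.\<close>

lemma sum_inverse_roots_unity:
  fixes z :: complex
  assumes "0 < N" "z ^ N \<noteq> 1"
  shows "(\<Sum>w\<in>roots_unity N. 1 / (1 - w * z)) = of_nat N / (1 - z ^ N)"
proof -
  have "1 / (1 - w * z) = (\<Sum>n<N. w ^ n * z ^ n) / (1 - z ^ N)" if "w \<in> roots_unity N" for w
  proof -
    have "(w * z) ^ N = z ^ N" using that by (simp add: power_mult_distrib)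
    then have "(1 - w * z) * (\<Sum>n<N. w ^ n * z ^ n) = 1 - z ^ N"
      using one_diff_power_eq[of "w * z" N] by (simp only: power_mult_distrib)
    moreover have "1 - w * z \<noteq> 0" using \<open>(w * z) ^ N = z ^ N\<close> assms by auto
    ultimately show ?thesis using assms(2) by (simp add: field_simps)
  qed
  then have "(\<Sum>w\<in>roots_unity N. 1 / (1 - w * z))
      = (\<Sum>w\<in>roots_unity N. \<Sum>n<N. w ^ n * z ^ n) / (1 - z ^ N)"
    by (simp add: sum_divide_distrib)
  also have "(\<Sum>w\<in>roots_unity N. \<Sum>n<N. w ^ n * z ^ n)
      = (\<Sum>n<N. (\<Sum>w\<in>roots_unity N. w ^ n) * z ^ n)"
    by (subst sum.swap) (simp add: sum_distrib_right)
  also have "\<dots> = (\<Sum>n<N. if n = 0 then of_nat N else 0)"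
    using assms by (intro sum.cong) (auto simp: sum_power_roots_unity card_roots_unity_eq)
  also have "\<dots> = of_nat N" using assms by simp
  finally show ?thesis .
qed

section \<open>The conjugate Poisson kernel over the roots of unity\<close>

lemma cmod_1_mult: "cmod w = 1 \<Longrightarrow> cmod u = 1 \<Longrightarrow> cmod (w * u) = 1"
  by (simp add: norm_mult)

lemma Re_le_1: "cmod z = 1 \<Longrightarrow> Re z \<le> 1"
  using complex_Re_le_cmod[of z] by simp

lemma t_plus_inverse_gt_2:
  fixes t :: real
  assumes "0 < t" "t < 1"
  shows "2 < t + 1 / t"
proof -
  have "0 < (1 - t)\<^sup>2 / t" using assms by simp
  also have "(1 - t)\<^sup>2 / t = t + 1 / t - 2" using assms by (simp add: field_simps power2_eq_square)
  finally show ?thesis by simp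
qed

text \<open>For \<open>z\<close> on the unit circle, the squared modulus of \<open>1 - t * z\<close>
  is \<open>t * (t + 1 / t - 2 * Re z)\<close>.\<close>

lemma Im_inverse_1_minus:
  fixes t :: real
  assumes "0 < t" "cmod z = 1"
  shows "Im (1 / (1 - of_real t * z)) = Im z / (t + 1 / t - 2 * Re z)"
proof -
  have n: "(Re z)\<^sup>2 + (Im z)\<^sup>2 = 1" using assms(2) by (simp add: cmod_def)
  have "(1 - t * Re z)\<^sup>2 + (t * Im z)\<^sup>2 = 1 - 2 * t * Re z + t\<^sup>2 * ((Re z)\<^sup>2 + (Im z)\<^sup>2)"
    by (simp add: power2_eq_square algebra_simps)
  also have "\<dots> = t * (t + 1 / t - 2 * Re z)"
    using n assms(1) by (simp add: power2_eq_square algebra_simps)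
  finally show ?thesis using assms(1) by (simp add: Im_divide)
qed

text \<open>Taking imaginary parts in the summation formula at the point \<open>t * u\<close>
  reproduces the same kernel, with \<open>t ^ N\<close> and \<open>u ^ N\<close> in place of
  \<open>t\<close> and \<open>u\<close>.\<close>

lemma sum_Im_roots_unity:
  fixes t :: real
  assumes "0 < N" "0 < t" "t < 1" "cmod u = 1"
  shows "(\<Sum>w\<in>roots_unity N. Im (w * u) / (t + 1 / t - 2 * Re (w * u)))
    = real N * Im (u ^ N) / (t ^ N + 1 / t ^ N - 2 * Re (u ^ N))"
proof -
  have "cmod ((of_real t * u) ^ N) < 1"
    using assms by (simp add: norm_mult norm_power power_less_one_iff)
  then have ne: "(of_real t * u) ^ N \<noteq> 1" by auto
  have "(\<Sum>w\<in>roots_unity N. Im (w * u) / (t + 1 / t - 2 * Re (w * u)))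
      = (\<Sum>w\<in>roots_unity N. Im (1 / (1 - of_real t * (w * u))))"
    using norm_root_unity[OF _ assms(1)] assms
    by (intro sum.cong refl Im_inverse_1_minus[symmetric] cmod_1_mult) auto
  also have "\<dots> = Im (\<Sum>w\<in>roots_unity N. 1 / (1 - w * (of_real t * u)))"
    by (simp add: Im_sum algebra_simps)
  also have "\<dots> = Im (of_nat N * (1 / (1 - of_real (t ^ N) * u ^ N)))"
    unfolding sum_inverse_roots_unity[OF assms(1) ne] by (simp add: power_mult_distrib)
  also have "\<dots> = real N * Im (1 / (1 - of_real (t ^ N) * u ^ N))"
  proof -
    have "Im (of_nat N * c) = real N * Im c" for c by simp
    then show ?thesis .
  qed
  also have "\<dots> = real N * Im (u ^ N) / (t ^ N + 1 / t ^ N - 2 * Re (u ^ N))"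
    using assms by (subst Im_inverse_1_minus) (simp_all add: norm_power)
  finally show ?thesis .
qed

lemma exists_plus_inverse_eq:
  fixes R :: real
  assumes "2 < R"
  obtains t where "0 < t" "t < 1" "t + 1 / t = R"
proof -
  define s where "s = sqrt (R\<^sup>2 - 4)"
  have "2\<^sup>2 < R\<^sup>2" by (rule power_strict_mono) (use assms in auto)
  then have s: "s\<^sup>2 = R\<^sup>2 - 4" "0 < s" by (simp_all add: s_def)
  have "s\<^sup>2 < R\<^sup>2" using s by linarith
  then have "s < R" using assms power2_less_imp_less[of s R] by linarith
  have "(R - 2)\<^sup>2 = s\<^sup>2 - 4 * (R - 2)" unfolding s by (simp add: power2_eq_square algebra_simps)
  then have "(R - 2)\<^sup>2 < s\<^sup>2" by (rule ord_eq_less_trans) (use assms in simp)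
  then have "R - 2 < s" using s power2_less_imp_less[of "R - 2" s] by linarith
  \<comment> \<open>The smaller root of the quadratic \<open>t\<^sup>2 - R * t + 1\<close>; the two
    roots have product 1.\<close>
  define t where "t = (R - s) / 2"
  have t: "0 < t" "t < 1" using \<open>s < R\<close> \<open>R - 2 < s\<close> by (simp_all add: t_def)
  have "4 * (t\<^sup>2 + 1) = R\<^sup>2 - 2 * R * s + s\<^sup>2 + 4"
    by (simp add: t_def power_divide power2_diff)
  also have "\<dots> = 4 * (R * t)" unfolding s t_def by (simp add: power2_eq_square algebra_simps)
  finally have "t\<^sup>2 + 1 = R * t" by simp
  then have "(t\<^sup>2 + 1) / t = R" using t by simp
  then have "t + 1 / t = R" using t by (simp add: add_divide_distrib power2_eq_square)
  then show ?thesis using that t by blast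
qed

text \<open>Differentiating the previous identity in \<open>t\<close> squares the denominators on
  both sides. The inner derivatives contribute factors of one sign because \<open>t < 1\<close>, so
  the quotient \<open>K\<close> is positive.\<close>

lemma sum_Im_roots_unity_square:
  assumes "0 < N" "2 < R" "cmod u = 1"
  shows "\<exists>K>0. (\<Sum>w\<in>roots_unity N. Im (w * u) / (R - 2 * Re (w * u))\<^sup>2) = K * Im (u ^ N)"
proof -
  obtain t where t0: "0 < t" and t1: "t < 1" and Rt: "t + 1 / t = R"
    using exists_plus_inverse_eq[OF assms(2)] .
  define Q where "Q s n z = s ^ n + 1 / s ^ n - 2 * Re z" for s :: real and n and z
  have Q: "0 < Q s n z" if "0 < s" "s < 1" "0 < n" "cmod z = 1" for s n z
  proof -
    have "0 < s ^ n" "s ^ n < 1" using that by (simp_all add: power_less_one_iff)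
    then show ?thesis
      using t_plus_inverse_gt_2[of "s ^ n"] Re_le_1[OF that(4)] unfolding Q_def by linarith
  qed
  have deriv: "((\<lambda>s. Im z / Q s n z) has_real_derivative
      (real n * t ^ (n - 1) * (1 / (t ^ n)\<^sup>2 - 1)) * (Im z / (Q t n z)\<^sup>2)) (at t)"
    if "0 < n" "cmod z = 1" for n z
  proof -
    have "((\<lambda>s. Q s n z) has_real_derivative real n * t ^ (n - 1) * (1 - 1 / (t ^ n)\<^sup>2)) (at t)"
      using t0 unfolding Q_def
      by (auto intro!: derivative_eq_intros simp: power2_eq_square right_diff_distrib)
    from DERIV_cmult[OF DERIV_inverse_fun[OF this], of "Im z"] Q[OF t0 t1 that]
    show ?thesis by (simp add: divide_inverse power2_eq_square algebra_simps)
  qed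
  have wu: "cmod (w * u) = 1" if "w \<in> roots_unity N" for w
    using cmod_1_mult norm_root_unity[OF that assms(1)] assms(3) by blast
  have d1: "((\<lambda>s. \<Sum>w\<in>roots_unity N. Im (w * u) / Q s 1 (w * u)) has_real_derivative
      (\<Sum>w\<in>roots_unity N. (1 / t\<^sup>2 - 1) * (Im (w * u) / (Q t 1 (w * u))\<^sup>2))) (at t)"
    using deriv[OF zero_less_one wu] by (intro DERIV_sum) (simp del: times_complex.sel)
  have uN: "cmod (u ^ N) = 1" using assms(3) by (simp add: norm_power)
  have d2: "((\<lambda>s. real N * (Im (u ^ N) / Q s N (u ^ N))) has_real_derivative
      real N * ((real N * t ^ (N - 1) * (1 / (t ^ N)\<^sup>2 - 1)) * (Im (u ^ N) / (Q t N (u ^ N))\<^sup>2)))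
      (at t)"
    by (intro DERIV_cmult deriv assms uN)
  \<comment> \<open>The closed form holds on the whole interval between 0 and 1, hence near
    \<open>t\<close>, so the two derivatives at \<open>t\<close> agree.\<close>
  have ev: "eventually (\<lambda>s. (\<Sum>w\<in>roots_unity N. Im (w * u) / Q s 1 (w * u))
      = real N * (Im (u ^ N) / Q s N (u ^ N))) (nhds t)"
  proof (rule eventually_nhds_in_open[of "{0<..<1}", THEN eventually_mono])
    fix s :: real assume "s \<in> {0<..<1}"
    then show "(\<Sum>w\<in>roots_unity N. Im (w * u) / Q s 1 (w * u))
        = real N * (Im (u ^ N) / Q s N (u ^ N))"
      using sum_Im_roots_unity[OF assms(1) _ _ assms(3), of s] by (simp add: Q_def)
  qed (use t0 t1 in auto)
  have scaled: "(1 / t\<^sup>2 - 1) * (\<Sum>w\<in>roots_unity N. Im (w * u) / (Q t 1 (w * u))\<^sup>2)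
      = real N * ((real N * t ^ (N - 1) * (1 / (t ^ N)\<^sup>2 - 1)) * (Im (u ^ N) / (Q t N (u ^ N))\<^sup>2))"
    using DERIV_unique[OF d1 iffD2[OF DERIV_cong_ev[OF refl ev refl] d2]]
    by (simp only: sum_distrib_left)
  have pos: "0 < 1 / (t ^ n)\<^sup>2 - 1" if "0 < n" for n
  proof -
    have "0 < (t ^ (n * 2))" "t ^ (n * 2) < 1" using t0 t1 that by (simp_all add: power_less_one_iff)
    then show ?thesis unfolding power_mult by simp
  qed
  have "1 / t\<^sup>2 - 1 > 0" using pos[of 1] by simp
  have "(\<Sum>w\<in>roots_unity N. Im (w * u) / (Q t 1 (w * u))\<^sup>2)
      = (real N * (real N * t ^ (N - 1) * (1 / (t ^ N)\<^sup>2 - 1)) / (Q t N (u ^ N))\<^sup>2 / (1 / t\<^sup>2 - 1))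
        * Im (u ^ N)"
  proof -
    have solve: "S = n * k / q / c * i" if "c * S = n * (k * (i / q))" "0 < c" for c S n k i q :: real
    proof -
      have "S = n * (k * (i / q)) / c" unfolding that(1)[symmetric] using that(2) by simp
      then show ?thesis by simp
    qed
    show ?thesis by (rule solve[OF scaled \<open>1 / t\<^sup>2 - 1 > 0\<close>])
  qed
  moreover have "0 < real N * (real N * t ^ (N - 1) * (1 / (t ^ N)\<^sup>2 - 1)) / (Q t N (u ^ N))\<^sup>2
      / (1 / t\<^sup>2 - 1)"
    using assms(1) t0 pos[OF assms(1)] \<open>1 / t\<^sup>2 - 1 > 0\<close> Q[OF t0 t1 assms(1) uN]
    by (intro divide_pos_pos mult_pos_pos zero_less_power) simp_all
  moreover have Q1: "Q t 1 (w * u) = R - 2 * Re (w * u)" for w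
    using Rt by (simp add: Q_def)
  ultimately show ?thesis unfolding Q1 by (rule_tac exI, rule_tac conjI)
qed

section \<open>The sign of sums weighted by inverse cubed distances\<close>

lemma sgn_limit_eq_sgn_deriv:
  fixes G :: "real \<Rightarrow> real"
  assumes G0: "G 0 = 0" and G': "\<And>v. \<exists>K>0. (G has_real_derivative K * s) (at v)"
    and lim: "(G \<longlongrightarrow> L) at_top"
  shows "sgn L = sgn s"
proof -
  have "\<forall>v. \<exists>K. 0 < K \<and> (G has_real_derivative K * s) (at v)" using G' by blast
  from choice[OF this] obtain D
    where D: "\<And>v. 0 < D v" "\<And>v. (G has_real_derivative D v * s) (at v)" by blast
  \<comment> \<open>The factor \<open>D\<close> is only known to be positive, so increments are
    estimated by the mean value theorem and not by integration.\<close>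
  have mono: "\<exists>K>0. G v' - G v = (v' - v) * (K * s)" if vv: "v < v'" for v v'
  proof -
    obtain z where "G v' - G v = (v' - v) * (D z * s)"
      using MVT2[OF vv, of G "\<lambda>v. D v * s"] D(2) by blast
    then show ?thesis using D(1) by blast
  qed
  \<comment> \<open>Strict inequalities are lost in the limit. Comparing with \<open>G 1\<close>
    instead of \<open>G 0\<close> keeps the gap \<open>s * G 1 = K * (s * s)\<close>, which is
    positive unless \<open>s = 0\<close>.\<close>
  have le: "s * G 1 \<le> s * G v" if v: "1 < v" for v
  proof -
    obtain K where K: "K > 0" "G v - G 1 = (v - 1) * (K * s)" using mono[OF v] by blast
    have "s * G v - s * G 1 = s * ((v - 1) * (K * s))"
      unfolding K(2)[symmetric] by (simp add: right_diff_distrib)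
    also have "\<dots> = (v - 1) * K * (s * s)" by simp
    also have "\<dots> \<ge> 0" using v K(1) mult_nonneg_nonneg[of "(v - 1) * K" "s * s"] by simp
    finally show ?thesis by simp
  qed
  have "s * G 1 \<le> s * L"
  proof (rule tendsto_lowerbound[OF tendsto_mult_left[OF lim]])
    show "eventually (\<lambda>v. s * G 1 \<le> s * G v) at_top"
      using eventually_gt_at_top[of 1] by (rule eventually_mono) (rule le)
  qed simp
  moreover obtain K where "K > 0" "G 1 = K * s" using mono[of 0 1] G0 by auto
  ultimately have sL: "K * (s * s) \<le> s * L" by (simp add: mult_ac)
  show ?thesis
  proof (cases "s = 0")
    case True
    have "eventually (\<lambda>v. G v = 0) at_top"
      using eventually_gt_at_top[of 0]
    proof (rule eventually_mono)
      fix v :: real assume "0 < v"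
      from mono[OF this] show "G v = 0" using True G0 by auto
    qed
    then have "(G \<longlongrightarrow> 0) at_top" by (rule tendsto_eventually)
    then have "L = 0" using tendsto_unique[OF _ lim] by simp
    then show ?thesis using True by simp
  next
    case False
    then have "0 < K * (s * s)" using \<open>K > 0\<close> by (metis mult_pos_pos not_real_square_gt_zero)
    then have "0 < s * L" using sL by linarith
    then show ?thesis by (auto simp: zero_less_mult_iff)
  qed
qed

text \<open>The weighted sum \<open>G\<close> of antiderivatives vanishes at 0 and tends to
  \<open>pi / 4\<close> times the sum in question, while its derivative is everywhere a positive
  multiple of \<open>Im (u ^ N)\<close>.\<close>

lemma sgn_sum_Im_roots_unity:
  assumes "0 < N" "2 < r" "cmod u = 1"
  shows "sgn (\<Sum>w\<in>roots_unity N. Im (w * u) / sqrt (r - 2 * Re (w * u)) ^ 3) = sgn (Im (u ^ N))"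
proof -
  define x where "x w = r - 2 * Re (w * u)" for w
  \<comment> \<open>\<open>F y\<close> is the antiderivative of \<open>1 / (y + v\<^sup>2)\<^sup>2\<close> vanishing at \<open>0\<close>.\<close>
  define F where "F y v = v / (2 * y * (y + v\<^sup>2)) + arctan (v / sqrt y) / (2 * sqrt y ^ 3)" for y v :: real
  define G where "G v = (\<Sum>w\<in>roots_unity N. Im (w * u) * F (x w) v)" for v
  have x: "0 < x w" if "w \<in> roots_unity N" for w
    using Re_le_1[OF cmod_1_mult[OF norm_root_unity[OF that assms(1)] assms(3)]] assms(2)
    by (simp add: x_def)
  have F': "(F y has_real_derivative 1 / (y + v\<^sup>2)\<^sup>2) (at v)" if "0 < y" for y v
  proof -
    have y: "0 < y + v\<^sup>2" using that by (simp add: add_pos_nonneg)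
    have s: "sqrt y \<noteq> 0" "sqrt y ^ 2 = y" using that by auto
    have a: "((\<lambda>v. arctan (v / sqrt y)) has_real_derivative inverse (1 + (v / sqrt y)\<^sup>2) * (1 / sqrt y)) (at v)"
      by (rule DERIV_chain2[OF DERIV_arctan]) (rule DERIV_cdivide[OF DERIV_ident])
    have a2: "inverse (1 + (v / sqrt y)\<^sup>2) * (1 / sqrt y) = sqrt y / (y + v\<^sup>2)"
    proof -
      have "1 + (v / sqrt y)\<^sup>2 = (y + v\<^sup>2) / y" using s that by (simp add: power_divide add_divide_distrib)
      then have "inverse (1 + (v / sqrt y)\<^sup>2) * (1 / sqrt y) = (y / sqrt y) / (y + v\<^sup>2)" by simp
      then show ?thesis using that by (simp add: real_div_sqrt)
    qed
    have b: "((\<lambda>v. v / (2 * y * (y + v\<^sup>2))) has_real_derivative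
        (y - v\<^sup>2) / (2 * y * (y + v\<^sup>2)\<^sup>2)) (at v)"
    proof -
      have "((\<lambda>v. v / (2 * y * (y + v\<^sup>2))) has_real_derivative
          (1 * (2 * y * (y + v\<^sup>2)) - v * (2 * y * (2 * v))) / ((2 * y * (y + v\<^sup>2)) * (2 * y * (y + v\<^sup>2)))) (at v)"
        using y that by (intro DERIV_divide DERIV_ident) (auto intro!: derivative_eq_intros)
      also have "(1 * (2 * y * (y + v\<^sup>2)) - v * (2 * y * (2 * v))) = 2 * y * (y - v\<^sup>2)"
        by (simp add: power2_eq_square algebra_simps)
      also have "2 * y * (y - v\<^sup>2) / ((2 * y * (y + v\<^sup>2)) * (2 * y * (y + v\<^sup>2)))
          = (y - v\<^sup>2) / (2 * y * (y + v\<^sup>2)\<^sup>2)"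
      proof -
        have "2 * y * p / ((2 * y * q) * (2 * y * q)) = p / (2 * y * q\<^sup>2)" for p q
          using that by (simp add: power2_eq_square)
        then show ?thesis .
      qed
      finally show ?thesis .
    qed
    have "(F y has_real_derivative
        (y - v\<^sup>2) / (2 * y * (y + v\<^sup>2)\<^sup>2) + sqrt y / (y + v\<^sup>2) / (2 * sqrt y ^ 3)) (at v)"
      unfolding F_def using a b unfolding a2 by (intro DERIV_add DERIV_cdivide)
    also have "sqrt y / (y + v\<^sup>2) / (2 * sqrt y ^ 3) = 1 / (2 * y * (y + v\<^sup>2))"
      using s that by (simp add: power3_eq_cube)
    also have "(y - v\<^sup>2) / (2 * y * (y + v\<^sup>2)\<^sup>2) + \<dots> = 1 / (y + v\<^sup>2)\<^sup>2"
    proof -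
      have "1 / (2 * y * (y + v\<^sup>2)) = (y + v\<^sup>2) / (2 * y * (y + v\<^sup>2)\<^sup>2)"
        using y that by (simp add: power2_eq_square)
      then have "(y - v\<^sup>2) / (2 * y * (y + v\<^sup>2)\<^sup>2) + 1 / (2 * y * (y + v\<^sup>2))
          = (y - v\<^sup>2 + (y + v\<^sup>2)) / (2 * y * (y + v\<^sup>2)\<^sup>2)"
        by (simp only: add_divide_distrib)
      also have "y - v\<^sup>2 + (y + v\<^sup>2) = 2 * y" by simp
      finally show ?thesis using that by simp
    qed
    finally show ?thesis .
  qed
  have Flim: "(F y \<longlongrightarrow> pi / 4 / sqrt y ^ 3) at_top" if "0 < y" for y
  proof -
    have "((\<lambda>v. v / (2 * y * (y + v\<^sup>2))) \<longlongrightarrow> 0) at_top"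
      using that by real_asymp
    moreover have "filterlim (\<lambda>v. v / sqrt y) at_top at_top"
      using that by real_asymp
    then have "((\<lambda>v. arctan (v / sqrt y)) \<longlongrightarrow> pi / 2) at_top"
      by (rule filterlim_compose[OF tendsto_arctan_at_top])
    ultimately have "(F y \<longlongrightarrow> 0 + (pi / 2) / (2 * sqrt y ^ 3)) at_top"
      unfolding F_def using that by (intro tendsto_intros) auto
    then show ?thesis by simp
  qed
  have G0: "G 0 = 0" by (simp add: G_def F_def)
  have G': "\<exists>K>0. (G has_real_derivative K * Im (u ^ N)) (at v)" for v
  proof -
    \<comment> \<open>Adding \<open>v\<^sup>2\<close> to each denominator only shifts
      \<open>r\<close>, so the squared kernel appears with \<open>R = r + v\<^sup>2\<close>.\<close>
    have "2 < r + v\<^sup>2" using assms(2) zero_le_power2[of v] by linarith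
    moreover have "x w + v\<^sup>2 = (r + v\<^sup>2) - 2 * Re (w * u)" for w by (simp add: x_def)
    ultimately obtain K where "K > 0" "(\<Sum>w\<in>roots_unity N. Im (w * u) / (x w + v\<^sup>2)\<^sup>2) = K * Im (u ^ N)"
      using sum_Im_roots_unity_square[OF assms(1) _ assms(3), of "r + v\<^sup>2"]
      by (auto simp del: times_complex.sel)
    moreover have "(G has_real_derivative (\<Sum>w\<in>roots_unity N. Im (w * u) * (1 / (x w + v\<^sup>2)\<^sup>2))) (at v)"
      unfolding G_def by (intro DERIV_sum DERIV_cmult F' x)
    ultimately show ?thesis by (auto simp del: times_complex.sel)
  qed
  define L where "L = (\<Sum>w\<in>roots_unity N. Im (w * u) * (pi / 4 / sqrt (x w) ^ 3))"
  have Glim: "(G \<longlongrightarrow> L) at_top"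
    unfolding G_def L_def by (intro tendsto_intros Flim x)
  have "sgn L = sgn (Im (u ^ N))" by (rule sgn_limit_eq_sgn_deriv[OF G0 G' Glim])
  moreover have "L = pi / 4 * (\<Sum>w\<in>roots_unity N. Im (w * u) / sqrt (x w) ^ 3)"
    unfolding L_def sum_distrib_left by (intro sum.cong refl) (simp only: times_divide_eq_right mult.commute)
  ultimately show ?thesis unfolding x_def by (simp only: sgn_mult) simp
qed

subsection \<open>Reduction to two scalar equations\<close>

text \<open>The inward pull that the other vertices of a unit polygon with unit masses exert on the
  vertex 1.\<close>

definition ngon_sum :: "nat \<Rightarrow> real"
  where "ngon_sum N = (\<Sum>w\<in>roots_unity N - {1}. 1 / (2 * cmod (1 - w)))"

text \<open>The weights are the inverse cubed distances from one vertex to the vertices of the other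
  layer. For \<open>f\<close> constantly 1, \<open>Re\<close> and \<open>Im\<close> the values are
  \<open>S\<close>, \<open>Re T\<close> and \<open>Im T\<close>.\<close>

definition layer_sum :: "nat \<Rightarrow> real \<Rightarrow> complex \<Rightarrow> (complex \<Rightarrow> real) \<Rightarrow> real"
  where "layer_sum N h u f = (\<Sum>w\<in>roots_unity N. f (w * u) / sqrt (2 + h\<^sup>2 - 2 * Re (w * u)) ^ 3)"

lemma cmod_minus_1_square:
  assumes "cmod z = 1"
  shows "(cmod (z - 1))\<^sup>2 = 2 - 2 * Re z"
proof -
  have "(Re z)\<^sup>2 + (Im z)\<^sup>2 = 1" using assms by (simp add: cmod_def)
  moreover have "(cmod (z - 1))\<^sup>2 = (Re z)\<^sup>2 + (Im z)\<^sup>2 + 1 - 2 * Re z"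
    unfolding cmod_power2 minus_complex.sel one_complex.sel
    by (simp add: power2_eq_square algebra_simps)
  ultimately show ?thesis by simp
qed

lemma norm_layer:
  assumes "cmod z = 1"
  shows "norm (z - 1, h) = sqrt (2 + h\<^sup>2 - 2 * Re z)"
  unfolding norm_Pair by (simp add: cmod_minus_1_square[OF assms] algebra_simps)

text \<open>On the unit circle \<open>Re w - 1\<close> is minus half the squared chord, which gives
  the radial part. The tangential part cancels because conjugation permutes the roots other than
  1.\<close>

lemma sum_polygon_force:
  assumes "0 < N"
  shows "(\<Sum>w\<in>roots_unity N - {1}. (1 / cmod (w - 1) ^ 3) *\<^sub>R (w - 1)) = - of_real (ngon_sum N)"
    (is "?F = _")
proof (rule complex_eqI)
  have "1 / cmod (w - 1) ^ 3 * (Re w - 1) = - (1 / (2 * cmod (1 - w)))"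
    if "w \<in> roots_unity N - {1}" for w
  proof -
    have "cmod w = 1" using norm_root_unity[OF _ assms] that by blast
    then have R: "Re w - 1 = - ((cmod (w - 1))\<^sup>2 / 2)" by (simp add: cmod_minus_1_square field_simps)
    have "cmod (w - 1) \<noteq> 0" using that by simp
    then show ?thesis unfolding R norm_minus_commute[of 1 w]
      by (simp add: power2_eq_square power3_eq_cube)
  qed
  then have "Re ?F = (\<Sum>w\<in>roots_unity N - {1}. - (1 / (2 * cmod (1 - w))))"
    unfolding Re_sum by (intro sum.cong refl) simp
  then show "Re ?F = Re (- of_real (ngon_sum N))" by (simp add: ngon_sum_def sum_negf)
  have b: "bij_betw cnj (roots_unity N - {1}) (roots_unity N - {1})"
    by (rule bij_betw_byWitness[where f' = cnj]) (auto simp flip: complex_cnj_power)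
  have "cnj ?F = (\<Sum>w\<in>roots_unity N - {1}. (1 / cmod (cnj w - 1) ^ 3) *\<^sub>R (cnj w - 1))"
  proof -
    have "cmod (cnj w - 1) = cmod (w - 1)" for w
      by (metis complex_cnj_diff complex_cnj_one complex_mod_cnj)
    then show ?thesis by (simp add: cnj_sum)
  qed
  also have "\<dots> = ?F" by (rule sum.reindex_bij_betw[OF b])
  finally have "Im (cnj ?F) = Im ?F" by (rule arg_cong)
  then have "Im ?F = 0" unfolding cnj.sel by linarith
  then show "Im ?F = Im (- of_real (ngon_sum N))" by (simp only:) simp
qed

lemma sum_layer_force:
  assumes "0 < N" "cmod u = 1"
  shows "(\<Sum>w\<in>roots_unity N. (1 / norm (w * u - 1, h) ^ 3) *\<^sub>R (w * u - 1, h))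
    = (Complex (layer_sum N h u Re - layer_sum N h u (\<lambda>_. 1)) (layer_sum N h u Im),
       h * layer_sum N h u (\<lambda>_. 1))"
    (is "?F = _")
proof -
  have d: "norm (w * u - 1, h) = sqrt (2 + h\<^sup>2 - 2 * Re (w * u))" if "w \<in> roots_unity N" for w
    by (rule norm_layer[OF cmod_1_mult[OF norm_root_unity[OF that assms(1)] assms(2)]])
  have "?F = (\<Sum>w\<in>roots_unity N. (1 / sqrt (2 + h\<^sup>2 - 2 * Re (w * u)) ^ 3) *\<^sub>R (w * u - 1, h))"
    using d by (intro sum.cong refl) (simp only:)
  moreover have "Re (fst \<dots>) = layer_sum N h u Re - layer_sum N h u (\<lambda>_. 1)"
    unfolding layer_sum_def sum_subtractf[symmetric] fst_sum Re_sum
    by (intro sum.cong refl) (simp add: diff_divide_distrib)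
  moreover have "Im (fst (\<Sum>w\<in>roots_unity N. (1 / sqrt (2 + h\<^sup>2 - 2 * Re (w * u)) ^ 3) *\<^sub>R (w * u - 1, h)))
      = layer_sum N h u Im"
    unfolding layer_sum_def fst_sum Im_sum by (intro sum.cong refl) simp
  moreover have "snd (\<Sum>w\<in>roots_unity N. (1 / sqrt (2 + h\<^sup>2 - 2 * Re (w * u)) ^ 3) *\<^sub>R (w * u - 1, h))
      = h * layer_sum N h u (\<lambda>_. 1)"
    unfolding layer_sum_def snd_sum sum_distrib_left by (intro sum.cong refl) simp
  ultimately show ?thesis by (simp add: prod_eq_iff complex_eq_iff)
qed

text \<open>Rotation by the vertex \<open>k\<close> permutes the polygon, so a sum over all vertices
  can be written as seen from any chosen \<open>k\<close>. This moves every force computation to the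
  vertex 1.\<close>

lemma sum_vertices:
  fixes f :: "complex \<Rightarrow> 'a::comm_monoid_add"
  assumes "0 < N"
  shows "(\<Sum>j\<in>{1..N}. f (cis (2 * real j * pi / real N)))
    = (\<Sum>w\<in>roots_unity N. f (cis (2 * real k * pi / real N) * w))"
  using sum.reindex_bij_betw[OF bij_betw_roots_unity_cis[OF assms], of f]
    sum.reindex_bij_betw[OF bij_betw_mult_root_unity[OF cis_root_unity[OF assms] assms], of f k]
  by (simp only:)

lemma sum_vertices_minus:
  fixes f :: "complex \<Rightarrow> 'a::ab_group_add"
  assumes "0 < N" "k \<in> {1..N}"
  shows "(\<Sum>j\<in>{1..N} - {k}. f (cis (2 * real j * pi / real N)))
    = (\<Sum>w\<in>roots_unity N - {1}. f (cis (2 * real k * pi / real N) * w))"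
  using sum_vertices[OF assms(1), of f k] assms
  by (simp add: sum_diff1 finite_roots_unity)

text \<open>From an upper vertex the lower polygon appears twisted by the opposite angle.
  Conjugating the summation index lets the sums over \<open>w * u\<close> be reused there.\<close>

lemma sum_vertices_cnj:
  fixes f :: "complex \<Rightarrow> 'a::comm_monoid_add"
  assumes "0 < N"
  shows "(\<Sum>j\<in>{1..N}. f (cis (2 * real j * pi / real N)))
    = (\<Sum>w\<in>roots_unity N. f (cis (2 * real k * pi / real N) * cnj w))"
  using sum_vertices[OF assms, of f k]
    sum.reindex_bij_betw[OF bij_betw_cnj_roots_unity, of "\<lambda>w. f (cis (2 * real k * pi / real N) * w)" N]
  by (simp only:)

lemma norm_rotate: "cmod \<rho> = 1 \<Longrightarrow> norm (\<rho> * z, h :: real) = norm (z, h)"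
  by (simp add: norm_Pair norm_mult)

lemma cmod_rotate: "cmod \<rho> = 1 \<Longrightarrow> cmod (\<rho> * z) = cmod z"
  by (simp add: norm_mult)

lemma norm_cnj_Pair: "norm (cnj z, h :: real) = norm (z, h)"
  by (simp add: norm_Pair)

lemma norm_uminus_Pair: "norm (z :: complex, - h :: real) = norm (z, h)"
  by (simp add: norm_Pair)

lemma norm_Pair_0: "norm (z :: complex, 0 :: real) = cmod z"
  by (simp add: norm_Pair)

lemma scaleR_Pair_sum_fst:
  assumes "(\<Sum>w\<in>A. c w *\<^sub>R z w) = (Z :: complex)"
  shows "(\<Sum>w\<in>A. (a * c w) *\<^sub>R (\<rho> * z w, 0 :: real)) = a *\<^sub>R (\<rho> * Z, 0)"
proof -
  have "(\<Sum>w\<in>A. (a * c w) *\<^sub>R (\<rho> * z w)) = a *\<^sub>R (\<rho> * Z)"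
    unfolding assms[symmetric] sum_distrib_left scaleR_sum_right by simp
  then show ?thesis by (simp add: prod_eq_iff fst_sum snd_sum)
qed

text \<open>The first form carries the force of the upper layer to a lower vertex. The second,
  reflected in the plane and in height, serves the force of the lower layer on an upper
  vertex.\<close>

lemma scaleR_Pair_sum:
  assumes "(\<Sum>w\<in>A. c w *\<^sub>R (z w, h :: real)) = (Z :: complex, H)"
  shows "(\<Sum>w\<in>A. (a * c w) *\<^sub>R (\<rho> * z w, h)) = a *\<^sub>R (\<rho> * Z, H)"
    and "(\<Sum>w\<in>A. (a * c w) *\<^sub>R (\<rho> * cnj (z w), - h)) = a *\<^sub>R (\<rho> * cnj Z, - H)"
proof -
  have Z: "(\<Sum>w\<in>A. c w *\<^sub>R z w) = Z" and H: "(\<Sum>w\<in>A. c w * h) = H"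
    using arg_cong[OF assms, of fst] arg_cong[OF assms, of snd] by (simp_all add: fst_sum snd_sum)
  have Z1: "(\<Sum>w\<in>A. (a * c w) *\<^sub>R (\<rho> * z w)) = a *\<^sub>R (\<rho> * Z)"
    unfolding Z[symmetric] sum_distrib_left scaleR_sum_right by simp
  have Z2: "(\<Sum>w\<in>A. (a * c w) *\<^sub>R (\<rho> * cnj (z w))) = a *\<^sub>R (\<rho> * cnj Z)"
    unfolding Z[symmetric] sum_distrib_left scaleR_sum_right cnj_sum by simp
  have H1: "(\<Sum>w\<in>A. (a * c w) * h) = a * H"
    unfolding H[symmetric] sum_distrib_left by (simp add: mult.assoc)
  show "(\<Sum>w\<in>A. (a * c w) *\<^sub>R (\<rho> * z w, h)) = a *\<^sub>R (\<rho> * Z, H)"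
    using Z1 H1 by (simp add: prod_eq_iff fst_sum snd_sum)
  show "(\<Sum>w\<in>A. (a * c w) *\<^sub>R (\<rho> * cnj (z w), - h)) = a *\<^sub>R (\<rho> * cnj Z, - H)"
    using Z2 H1 by (simp add: prod_eq_iff fst_sum snd_sum sum_negf)
qed

section \<open>Center of mass and forces of the two layers\<close>

lemma two_ngons_center_of_mass:
  assumes "2 \<le> N" "0 < b" "0 < m"
  shows "center_of_mass (two_ngons_index N) (two_ngons_mass b m) (two_ngons_position N 1 h \<theta>)
    = (0, b * h / (1 + b))"
proof -
  have N: "0 < N" using assms by simp
  have s: "(\<Sum>j\<in>{1..N}. cis (2 * real j * pi / real N)) = 0"
    using sum.reindex_bij_betw[OF bij_betw_roots_unity_cis[OF N], of "\<lambda>z. z"] sum_roots_unity[of N] assms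
    by simp
  have M: "(\<Sum>j\<in>two_ngons_index N. two_ngons_mass b m j) = real N * m * (1 + b)"
    by (simp add: two_ngons_index_def two_ngons_mass_def sum.Plus algebra_simps)
  have "(\<Sum>j\<in>two_ngons_index N. two_ngons_mass b m j *\<^sub>R two_ngons_position N 1 h \<theta> j)
      = (m *\<^sub>R (\<Sum>j\<in>{1..N}. cis (2 * real j * pi / real N))
          + (b * m) *\<^sub>R ((\<Sum>j\<in>{1..N}. cis (2 * real j * pi / real N)) * cis \<theta>), real N * (b * m * h))"
    by (simp add: two_ngons_index_def two_ngons_mass_def two_ngons_position_def sum.Plus prod_eq_iff
        fst_sum snd_sum scaleR_sum_right sum_distrib_right)
  also have "\<dots> = (0, real N * (b * m * h))" unfolding s by simp
  finally show ?thesis unfolding center_of_mass_def M using assms N by simp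
qed

lemma inj_on_two_ngons_position:
  assumes "0 < N" "h \<noteq> 0"
  shows "inj_on (two_ngons_position N 1 h \<theta>) (two_ngons_index N)"
proof -
  have vertex: "j = k" if "cis (2 * real j * pi / real N) = cis (2 * real k * pi / real N)"
    "j \<in> {1..N}" "k \<in> {1..N}" for j k
    using bij_betw_roots_unity_cis[OF assms(1)] that unfolding bij_betw_def inj_on_def by blast
  show ?thesis
  proof (rule inj_onI)
    fix i j
    assume "i \<in> two_ngons_index N" "j \<in> two_ngons_index N"
      and "two_ngons_position N 1 h \<theta> i = two_ngons_position N 1 h \<theta> j"
    then show "i = j"
      using assms(2) unfolding two_ngons_index_def two_ngons_position_def
      by (elim PlusE) (simp_all del: atLeastAtMost_iff One_nat_def, (rule vertex, assumption+)+)
  qed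
qed

context
  fixes N :: nat and b m h \<theta> :: real and u :: complex
  assumes N: "2 \<le> N" and b: "0 < b" and m: "0 < m" and h: "0 < h"
  defines "u \<equiv> cis \<theta>"
begin

text \<open>After the factor \<open>\<rho>\<close> is pulled out, the real part is the radial and
  the imaginary part the tangential component at the vertex. The own polygon contributes only
  \<open>- ngon_sum N\<close>.\<close>

lemma two_ngons_force_Inl:
  fixes k
  defines "x \<equiv> two_ngons_position N 1 h \<theta>" and "\<mu> \<equiv> two_ngons_mass b m"
    and "\<rho> \<equiv> cis (2 * real k * pi / real N)"
  assumes k: "k \<in> {1..N}"
  shows "(\<Sum>j\<in>two_ngons_index N - {Inl k}.
      (\<mu> j * \<mu> (Inl k) / norm (x j - x (Inl k)) ^ 3) *\<^sub>R (x j - x (Inl k)))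
    = (m * m) *\<^sub>R (\<rho> * Complex (b * (layer_sum N h u Re - layer_sum N h u (\<lambda>_. 1)) - ngon_sum N)
          (b * layer_sum N h u Im),
        b * (h * layer_sum N h u (\<lambda>_. 1)))"
proof -
  let ?\<rho> = "\<lambda>k::nat. cis (2 * real k * pi / real N)"
  have N0: "0 < N" using N by simp
  have \<rho>: "cmod \<rho> = 1" by (simp add: \<rho>_def)
  have u: "cmod u = 1" by (simp add: u_def)
  have I: "two_ngons_index N - {Inl k} = ({1..N} - {k}) <+> {1..N}"
    by (auto simp: two_ngons_index_def)
  have "(\<Sum>j\<in>two_ngons_index N - {Inl k}.
      (\<mu> j * \<mu> (Inl k) / norm (x j - x (Inl k)) ^ 3) *\<^sub>R (x j - x (Inl k)))
    = (\<Sum>j\<in>{1..N} - {k}. (m * m / norm (?\<rho> j - \<rho>, 0 :: real) ^ 3) *\<^sub>R (?\<rho> j - \<rho>, 0))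
      + (\<Sum>j\<in>{1..N}. (b * m * m / norm (?\<rho> j * u - \<rho>, h) ^ 3) *\<^sub>R (?\<rho> j * u - \<rho>, h))"
    unfolding I by (simp add: sum.Plus x_def \<mu>_def \<rho>_def u_def two_ngons_mass_def
        two_ngons_position_def)
  also have "(\<Sum>j\<in>{1..N} - {k}. (m * m / norm (?\<rho> j - \<rho>, 0 :: real) ^ 3) *\<^sub>R (?\<rho> j - \<rho>, 0 :: real))
      = (\<Sum>w\<in>roots_unity N - {1}. (m * m * (1 / cmod (w - 1) ^ 3)) *\<^sub>R (\<rho> * (w - 1), 0))"
  proof -
    have "\<rho> * w - \<rho> = \<rho> * (w - 1)" for w by (simp add: algebra_simps)
    then show ?thesis
      unfolding sum_vertices_minus[OF N0 k, of "\<lambda>z. (m * m / norm (z - \<rho>, 0 :: real) ^ 3) *\<^sub>R (z - \<rho>, 0 :: real)"]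
        \<rho>_def[symmetric]
      by (simp only: norm_Pair_0 cmod_rotate[OF \<rho>] times_divide_eq_right mult_1_right)
  qed
  also have "\<dots> = (m * m) *\<^sub>R (\<rho> * - of_real (ngon_sum N), 0)"
    by (rule scaleR_Pair_sum_fst[OF sum_polygon_force[OF N0]])
  also have "(\<Sum>j\<in>{1..N}. (b * m * m / norm (?\<rho> j * u - \<rho>, h) ^ 3) *\<^sub>R (?\<rho> j * u - \<rho>, h))
      = (\<Sum>w\<in>roots_unity N. (b * m * m * (1 / norm (w * u - 1, h) ^ 3)) *\<^sub>R (\<rho> * (w * u - 1), h))"
  proof -
    have "\<rho> * w * u - \<rho> = \<rho> * (w * u - 1)" for w by (simp add: algebra_simps)
    then show ?thesis
      unfolding sum_vertices[OF N0, of "\<lambda>z. (b * m * m / norm (z * u - \<rho>, h) ^ 3) *\<^sub>R (z * u - \<rho>, h)" k]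
        \<rho>_def[symmetric]
      by (simp only: norm_rotate[OF \<rho>] times_divide_eq_right mult_1_right)
  qed
  also have "\<dots> = (b * m * m) *\<^sub>R (\<rho> * Complex (layer_sum N h u Re - layer_sum N h u (\<lambda>_. 1)) (layer_sum N h u Im),
       h * layer_sum N h u (\<lambda>_. 1))"
    by (rule scaleR_Pair_sum(1)[OF sum_layer_force[OF N0 u]])
  also have "(m * m) *\<^sub>R (\<rho> * - of_real (ngon_sum N), 0) + \<dots>
    = (m * m) *\<^sub>R (\<rho> * Complex (b * (layer_sum N h u Re - layer_sum N h u (\<lambda>_. 1)) - ngon_sum N)
          (b * layer_sum N h u Im),
        b * (h * layer_sum N h u (\<lambda>_. 1)))"
    by (simp add: complex_eq_iff algebra_simps)
  finally show ?thesis .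
qed

lemma two_ngons_force_Inr:
  fixes k
  defines "x \<equiv> two_ngons_position N 1 h \<theta>" and "\<mu> \<equiv> two_ngons_mass b m"
    and "\<rho> \<equiv> cis (2 * real k * pi / real N)"
  assumes k: "k \<in> {1..N}"
  shows "(\<Sum>j\<in>two_ngons_index N - {Inr k}.
      (\<mu> j * \<mu> (Inr k) / norm (x j - x (Inr k)) ^ 3) *\<^sub>R (x j - x (Inr k)))
    = (b * m * m) *\<^sub>R (\<rho> * u * Complex (layer_sum N h u Re - layer_sum N h u (\<lambda>_. 1) - b * ngon_sum N)
          (- layer_sum N h u Im),
        - (h * layer_sum N h u (\<lambda>_. 1)))"
proof -
  let ?\<rho> = "\<lambda>k::nat. cis (2 * real k * pi / real N)"
  have N0: "0 < N" using N by simp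
  have u: "cmod u = 1" by (simp add: u_def)
  then have \<rho>: "cmod (\<rho> * u) = 1" by (simp add: \<rho>_def norm_mult)
  have I: "two_ngons_index N - {Inr k} = {1..N} <+> ({1..N} - {k})"
    by (auto simp: two_ngons_index_def)
  have "(\<Sum>j\<in>two_ngons_index N - {Inr k}.
      (\<mu> j * \<mu> (Inr k) / norm (x j - x (Inr k)) ^ 3) *\<^sub>R (x j - x (Inr k)))
    = (\<Sum>j\<in>{1..N}. (b * m * m / norm (?\<rho> j - \<rho> * u, - h) ^ 3) *\<^sub>R (?\<rho> j - \<rho> * u, - h))
      + (\<Sum>j\<in>{1..N} - {k}. (b * m * (b * m) / norm (?\<rho> j * u - \<rho> * u, 0 :: real) ^ 3) *\<^sub>R (?\<rho> j * u - \<rho> * u, 0))"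
    unfolding I by (simp add: sum.Plus x_def \<mu>_def \<rho>_def u_def two_ngons_mass_def
        two_ngons_position_def mult_ac)
  also have "(\<Sum>j\<in>{1..N} - {k}. (b * m * (b * m) / norm (?\<rho> j * u - \<rho> * u, 0 :: real) ^ 3) *\<^sub>R (?\<rho> j * u - \<rho> * u, 0 :: real))
      = (\<Sum>w\<in>roots_unity N - {1}. (b * m * (b * m) * (1 / cmod (w - 1) ^ 3)) *\<^sub>R (\<rho> * u * (w - 1), 0))"
  proof -
    have "\<rho> * w * u - \<rho> * u = \<rho> * u * (w - 1)" for w by (simp add: algebra_simps)
    then show ?thesis
      unfolding sum_vertices_minus[OF N0 k, of "\<lambda>z. (b * m * (b * m) / norm (z * u - \<rho> * u, 0 :: real) ^ 3) *\<^sub>R (z * u - \<rho> * u, 0 :: real)"]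
        \<rho>_def[symmetric]
      by (simp only: norm_Pair_0 cmod_rotate[OF \<rho>] times_divide_eq_right mult_1_right)
  qed
  also have "\<dots> = (b * m * (b * m)) *\<^sub>R (\<rho> * u * - of_real (ngon_sum N), 0)"
    by (rule scaleR_Pair_sum_fst[OF sum_polygon_force[OF N0]])
  also have "(\<Sum>j\<in>{1..N}. (b * m * m / norm (?\<rho> j - \<rho> * u, - h) ^ 3) *\<^sub>R (?\<rho> j - \<rho> * u, - h))
      = (\<Sum>w\<in>roots_unity N. (b * m * m * (1 / norm (w * u - 1, h) ^ 3)) *\<^sub>R (\<rho> * u * cnj (w * u - 1), - h))"
  proof -
    \<comment> \<open>This relation turns the difference of a lower and an upper vertex into a
      rotated conjugate of \<open>w * u - 1\<close>.\<close>
    have "u * cnj u = 1" using u by (simp add: complex_norm_square[symmetric])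
    then have "\<rho> * cnj w - \<rho> * u = \<rho> * u * cnj (w * u - 1)" for w
      by (simp add: algebra_simps)
    then show ?thesis
      unfolding sum_vertices_cnj[OF N0, of "\<lambda>z. (b * m * m / norm (z - \<rho> * u, - h) ^ 3) *\<^sub>R (z - \<rho> * u, - h)" k]
        \<rho>_def[symmetric]
      by (simp only: norm_rotate[OF \<rho>] norm_uminus_Pair norm_cnj_Pair times_divide_eq_right mult_1_right)
  qed
  also have "\<dots> = (b * m * m) *\<^sub>R (\<rho> * u * cnj (Complex (layer_sum N h u Re - layer_sum N h u (\<lambda>_. 1)) (layer_sum N h u Im)),
       - (h * layer_sum N h u (\<lambda>_. 1)))"
    by (rule scaleR_Pair_sum(2)[OF sum_layer_force[OF N0 u]])
  also have "\<dots> + (b * m * (b * m)) *\<^sub>R (\<rho> * u * - of_real (ngon_sum N), 0)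
    = (b * m * m) *\<^sub>R (\<rho> * u * Complex (layer_sum N h u Re - layer_sum N h u (\<lambda>_. 1) - b * ngon_sum N)
          (- layer_sum N h u Im),
        - (h * layer_sum N h u (\<lambda>_. 1)))"
    by (simp add: complex_eq_iff algebra_simps)
  finally show ?thesis .
qed

text \<open>The vertical equation of either layer says \<open>c = m * (1 + b) * S\<close>, so the
  multipliers agree automatically. Inserting this value into the two radial equations leaves the
  stated conditions, and the tangential ones say that the \<open>Im\<close> sum vanishes.\<close>

lemma two_ngons_central_iff:
  "two_ngons_central N 1 b m h \<theta> \<longleftrightarrow>
    layer_sum N h u Im = 0 \<and>
    ngon_sum N = layer_sum N h u (\<lambda>_. 1) + b * layer_sum N h u Re \<and>
    b * ngon_sum N = b * layer_sum N h u (\<lambda>_. 1) + layer_sum N h u Re"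
    (is "_ \<longleftrightarrow> ?R")
proof -
  define S where "S = layer_sum N h u (\<lambda>_. 1)"
  define T where "T = layer_sum N h u Re"
  define J where "J = layer_sum N h u Im"
  define P where "P = ngon_sum N"
  let ?x = "two_ngons_position N 1 h \<theta>" and ?\<mu> = "two_ngons_mass b m" and ?I = "two_ngons_index N"
  define F where "F k = (\<Sum>j\<in>?I - {k}. (?\<mu> j * ?\<mu> k / norm (?x j - ?x k) ^ 3) *\<^sub>R (?x j - ?x k))" for k
  define z where "z = (0 :: complex, b * h / (1 + b))"
  have N0: "0 < N" using N by simp
  \<comment> \<open>Dividing by the horizontal direction \<open>\<rho>\<close> of the vertex splits
    the vector equation into its radial, tangential and vertical parts.\<close>
  have eq: "a *\<^sub>R (\<rho> * X, s) = - c *\<^sub>R (\<rho>, t) \<longleftrightarrow> a * Re X = - c \<and> a * Im X = 0 \<and> a * s = - c * t"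
    if "\<rho> \<noteq> 0" for a c s t :: real and \<rho> X :: complex
  proof -
    have "a *\<^sub>R (\<rho> * X) = - c *\<^sub>R \<rho> \<longleftrightarrow> \<rho> * (a *\<^sub>R X + of_real c) = 0"
      by (simp add: scaleR_conv_of_real algebra_simps eq_neg_iff_add_eq_0)
    also have "\<dots> \<longleftrightarrow> a *\<^sub>R X + of_real c = 0" using that by simp
    also have "\<dots> \<longleftrightarrow> a * Re X = - c \<and> a * Im X = 0"
      by (simp add: complex_eq_iff eq_neg_iff_add_eq_0)
    finally show ?thesis by simp
  qed
  have rho: "cis t \<noteq> 0" "cis t * u \<noteq> 0" for t by (simp_all add: u_def)
  have L: "F (Inl k) = - (c * ?\<mu> (Inl k)) *\<^sub>R (?x (Inl k) - z) \<longleftrightarrow>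
      m * m * (b * (T - S) - P) = - (c * m) \<and> m * m * (b * J) = 0
      \<and> m * m * (b * (h * S)) = - (c * m) * (- (b * h / (1 + b)))" if "k \<in> {1..N}" for k c
    using eq[OF rho(1)[of "2 * real k * pi / real N"], of "m * m"
        "Complex (b * (T - S) - P) (b * J)" "b * (h * S)" "c * m" "- (b * h / (1 + b))"]
    unfolding F_def two_ngons_force_Inl[OF that] S_def[symmetric] T_def[symmetric] J_def[symmetric]
      P_def[symmetric]
    by (simp add: two_ngons_position_def two_ngons_mass_def z_def)
  have R: "F (Inr k) = - (c * ?\<mu> (Inr k)) *\<^sub>R (?x (Inr k) - z) \<longleftrightarrow>
      b * m * m * (T - S - b * P) = - (c * (b * m)) \<and> b * m * m * (- J) = 0
      \<and> b * m * m * (- (h * S)) = - (c * (b * m)) * (h - b * h / (1 + b))" if "k \<in> {1..N}" for k c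
    using eq[OF rho(2)[of "2 * real k * pi / real N"], of "b * m * m"
        "Complex (T - S - b * P) (- J)" "- (h * S)" "c * (b * m)" "h - b * h / (1 + b)"]
    unfolding F_def two_ngons_force_Inr[OF that] S_def[symmetric] T_def[symmetric] J_def[symmetric]
      P_def[symmetric]
    by (simp add: two_ngons_position_def two_ngons_mass_def z_def u_def)
  have bh: "h - b * h / (1 + b) = h / (1 + b)" using b by (simp add: field_simps)
  have L': "(m * m * (b * (T - S) - P) = - (c * m) \<and> m * m * (b * J) = 0
      \<and> m * m * (b * (h * S)) = - (c * m) * (- (b * h / (1 + b)))) \<longleftrightarrow>
      J = 0 \<and> c = m * (1 + b) * S \<and> P = S + b * T" for c
  proof -
    have "m * m * (b * (T - S) - P) = - (c * m) \<longleftrightarrow> m * (m * (b * (T - S) - P)) = m * (- c)"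
      by (simp add: mult_ac)
    then have 1: "m * m * (b * (T - S) - P) = - (c * m) \<longleftrightarrow> m * (b * (T - S) - P) = - c"
      by (simp only: mult_cancel_left order_less_imp_not_eq2[OF m] simp_thms)
    have "m * m * (b * (h * S)) = - (c * m) * (- (b * h / (1 + b))) \<longleftrightarrow>
        (m * b * h) * (m * S) = (m * b * h) * (c / (1 + b))" by (simp add: mult_ac)
    also have "\<dots> \<longleftrightarrow> m * S = c / (1 + b)"
      by (simp only: mult_cancel_left order_less_imp_not_eq2[OF mult_pos_pos[OF mult_pos_pos[OF m b] h]] simp_thms)
    also have "\<dots> \<longleftrightarrow> c = m * (1 + b) * S" using b by (auto simp: nonzero_eq_divide_eq mult_ac)
    finally have 2: "m * m * (b * (h * S)) = - (c * m) * (- (b * h / (1 + b))) \<longleftrightarrow> c = m * (1 + b) * S" .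
    have "m * (b * (T - S) - P) = - (m * (1 + b) * S) \<longleftrightarrow> m * (S + b * T - P) = 0"
      by (simp add: algebra_simps eq_neg_iff_add_eq_0)
    then have 3: "m * (b * (T - S) - P) = - (m * (1 + b) * S) \<longleftrightarrow> P = S + b * T" using m by auto
    show ?thesis unfolding 1 2 using 3 m b by auto
  qed
  have R': "(b * m * m * (T - S - b * P) = - (c * (b * m)) \<and> b * m * m * (- J) = 0
      \<and> b * m * m * (- (h * S)) = - (c * (b * m)) * (h - b * h / (1 + b))) \<longleftrightarrow>
      J = 0 \<and> c = m * (1 + b) * S \<and> b * P = b * S + T" for c
  proof -
    have "b * m * m * (T - S - b * P) = - (c * (b * m)) \<longleftrightarrow>
        (b * m) * (m * (T - S - b * P)) = (b * m) * (- c)" by (simp add: mult_ac)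
    then have 1: "b * m * m * (T - S - b * P) = - (c * (b * m)) \<longleftrightarrow> m * (T - S - b * P) = - c"
      by (simp only: mult_cancel_left order_less_imp_not_eq2[OF mult_pos_pos[OF b m]] simp_thms)
    have "b * m * m * (- (h * S)) = - (c * (b * m)) * (h / (1 + b)) \<longleftrightarrow>
        (b * m * h) * (m * S) = (b * m * h) * (c / (1 + b))" by (simp add: mult_ac)
    also have "\<dots> \<longleftrightarrow> m * S = c / (1 + b)"
      by (simp only: mult_cancel_left order_less_imp_not_eq2[OF mult_pos_pos[OF mult_pos_pos[OF b m] h]] simp_thms)
    also have "\<dots> \<longleftrightarrow> c = m * (1 + b) * S" using b by (auto simp: nonzero_eq_divide_eq mult_ac)
    finally have 2: "b * m * m * (- (h * S)) = - (c * (b * m)) * (h - b * h / (1 + b)) \<longleftrightarrow>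
        c = m * (1 + b) * S" unfolding bh .
    have "m * (T - S - b * P) = - (m * (1 + b) * S) \<longleftrightarrow> m * (b * S + T - b * P) = 0"
      by (simp add: algebra_simps eq_neg_iff_add_eq_0)
    then have 3: "m * (T - S - b * P) = - (m * (1 + b) * S) \<longleftrightarrow> b * P = b * S + T" using m by auto
    show ?thesis unfolding 1 2 using 3 m b by auto
  qed
  have fin: "finite ?I" "\<forall>i\<in>?I. 0 < ?\<mu> i"
    using b m by (auto simp: two_ngons_index_def two_ngons_mass_def)
  have d: "(?x j - z) - (?x k - z) = ?x j - ?x k" for j k by simp
  have "two_ngons_central N 1 b m h \<theta> \<longleftrightarrow>
      (\<exists>c. \<forall>k\<in>?I. F k = - (c * ?\<mu> k) *\<^sub>R (?x k - z))"
    unfolding two_ngons_central_def central_configuration_def Let_def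
      two_ngons_center_of_mass[OF N b m] z_def[symmetric] d F_def
    using fin inj_on_two_ngons_position[OF N0, of h \<theta>] h by simp
  also have "\<dots> \<longleftrightarrow> (\<exists>c. (\<forall>k\<in>{1..N}. F (Inl k) = - (c * ?\<mu> (Inl k)) *\<^sub>R (?x (Inl k) - z)) \<and>
      (\<forall>k\<in>{1..N}. F (Inr k) = - (c * ?\<mu> (Inr k)) *\<^sub>R (?x (Inr k) - z)))"
    by (auto simp: two_ngons_index_def)
  also have "\<dots> \<longleftrightarrow> (\<exists>c. (J = 0 \<and> c = m * (1 + b) * S \<and> P = S + b * T)
      \<and> (J = 0 \<and> c = m * (1 + b) * S \<and> b * P = b * S + T))"
  proof -
    \<comment> \<open>The reduced conditions no longer mention \<open>k\<close>, so quantifying over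
      a nonempty index set changes nothing.\<close>
    have ne: "{1..N} \<noteq> {}" using N0 by simp
    have l: "(\<forall>k\<in>{1..N}. F (Inl k) = - (c * ?\<mu> (Inl k)) *\<^sub>R (?x (Inl k) - z)) \<longleftrightarrow>
        (J = 0 \<and> c = m * (1 + b) * S \<and> P = S + b * T)" for c
      by (simp only: L L' cong: ball_cong) (use ne in blast)
    have r: "(\<forall>k\<in>{1..N}. F (Inr k) = - (c * ?\<mu> (Inr k)) *\<^sub>R (?x (Inr k) - z)) \<longleftrightarrow>
        (J = 0 \<and> c = m * (1 + b) * S \<and> b * P = b * S + T)" for c
      by (simp only: R R' cong: ball_cong) (use ne in blast)
    show ?thesis unfolding l r ..
  qed
  also have "\<dots> \<longleftrightarrow> J = 0 \<and> P = S + b * T \<and> b * P = b * S + T" by blast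
  finally show ?thesis unfolding S_def T_def J_def P_def .
qed

end

subsection \<open>Monotonicity in the distance of the layers\<close>

lemma layer_sum_add:
  "layer_sum N h u (\<lambda>z. f z + g z) = layer_sum N h u f + layer_sum N h u g"
  unfolding layer_sum_def by (simp only: add_divide_distrib sum.distrib)

lemma layer_radicand_pos:
  assumes "w \<in> roots_unity N" "0 < N" "cmod u = 1" "0 < h"
  shows "0 < 2 + h\<^sup>2 - 2 * Re (w * u)"
proof -
  have "Re (w * u) \<le> 1"
    by (rule Re_le_1[OF cmod_1_mult[OF norm_root_unity[OF assms(1,2)] assms(3)]])
  moreover have "0 < h\<^sup>2" using assms(4) by simp
  ultimately show ?thesis by linarith
qed

lemma sum_Re_roots_unity:
  assumes "2 \<le> N"
  shows "(\<Sum>w\<in>roots_unity N. Re (w * u)) = 0"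
proof -
  have "(\<Sum>w\<in>roots_unity N. w * u) = 0"
    using sum_roots_unity[of N] assms by (simp flip: sum_distrib_right)
  then have "Re (\<Sum>w\<in>roots_unity N. w * u) = 0" by (simp only: zero_complex.sel)
  then show ?thesis by (simp only: Re_sum)
qed

text \<open>The weight increases with \<open>x\<close>, so its difference from the value at 0 has
  the sign of \<open>x\<close>.\<close>

lemma inverse_sqrt_cube_mono:
  fixes r x :: real
  assumes "x \<noteq> 0" "0 < r" "0 < r - 2 * x"
  shows "0 < x * (1 / sqrt (r - 2 * x) ^ 3 - 1 / sqrt r ^ 3)"
proof (cases "0 < x")
  case True
  have "sqrt (r - 2 * x) ^ 3 < sqrt r ^ 3"
    by (rule power_strict_mono) (use True assms in simp_all)
  then have "1 / sqrt r ^ 3 < 1 / sqrt (r - 2 * x) ^ 3"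
    by (rule divide_strict_left_mono) (use assms in simp_all)
  then show ?thesis using True by simp
next
  case False
  have "sqrt r ^ 3 < sqrt (r - 2 * x) ^ 3"
    by (rule power_strict_mono) (use False assms in simp_all)
  then have "1 / sqrt (r - 2 * x) ^ 3 < 1 / sqrt r ^ 3"
    by (rule divide_strict_left_mono) (use assms in simp_all)
  then show ?thesis using False assms by (intro mult_neg_neg) simp_all
qed

text \<open>The real parts sum to 0, so subtracting from all weights their common value at real part
  0 does not change the sum. Every term is then nonnegative, and a vanishing total forces each one
  to vanish.\<close>

lemma layer_sum_Re_eq_0:
  assumes N: "2 \<le> N" and u: "cmod u = 1" and h: "0 < h" and zero: "layer_sum N h u Re = 0"
    and w: "w \<in> roots_unity N"
  shows "Re (w * u) = 0"
proof -
  have N0: "0 < N" using N by simp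
  define g where "g w = Re (w * u) * (1 / sqrt (2 + h\<^sup>2 - 2 * Re (w * u)) ^ 3 - 1 / sqrt (2 + h\<^sup>2) ^ 3)" for w
  have pos: "0 < g w" if "w \<in> roots_unity N" "Re (w * u) \<noteq> 0" for w
    unfolding g_def
    by (rule inverse_sqrt_cube_mono[OF that(2) _ layer_radicand_pos[OF that(1) N0 u h]])
      (simp add: add_pos_nonneg)
  have nonneg: "0 \<le> g w" if "w \<in> roots_unity N" for w
  proof (cases "Re (w * u) = 0")
    case True
    then show ?thesis by (simp only: g_def mult_zero_left order_refl)
  qed (use pos[OF that] in linarith)
  have "(\<Sum>w\<in>roots_unity N. g w)
      = layer_sum N h u Re - (\<Sum>w\<in>roots_unity N. Re (w * u)) * (1 / sqrt (2 + h\<^sup>2) ^ 3)"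
    unfolding layer_sum_def g_def sum_distrib_right sum_subtractf[symmetric]
    by (intro sum.cong refl) (simp only: right_diff_distrib times_divide_eq_right mult_1_right)
  also have "\<dots> = 0" by (simp only: zero sum_Re_roots_unity[OF N])
  finally have sum0: "(\<Sum>w\<in>roots_unity N. g w) = 0" .
  have "finite (roots_unity N)" using N0 by (intro finite_roots_unity) simp
  then have "g w = 0" using sum_nonneg_0[OF _ nonneg sum0 w] by blast
  then show ?thesis using pos[OF w] by (cases "Re (w * u) = 0") linarith+
qed

text \<open>Both \<open>u\<close> and its rotation by \<open>2 * pi / N\<close> lie on the imaginary
  axis, so the sine of that angle vanishes, which is impossible for \<open>N\<close> at least
  3.\<close>

lemma roots_unity_Re_0:
  assumes N: "2 \<le> N" and u: "cmod u = 1" and Re0: "\<And>w. w \<in> roots_unity N \<Longrightarrow> Re (w * u) = 0"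
  shows "N = 2" "Re u = 0"
proof -
  show u0: "Re u = 0" using Re0[of 1] by simp
  show "N = 2"
  proof (rule ccontr)
    assume "N \<noteq> 2"
    then have N3: "3 \<le> N" using N by simp
    have "Im u \<noteq> 0" using u u0 by (auto simp: cmod_def)
    moreover have "Re (cis (2 * real (1::nat) * pi / real N) * u) = 0"
      by (rule Re0[OF cis_root_unity]) (use N in simp)
    ultimately have "sin (2 * pi / real N) = 0" using u0 by simp
    moreover have "0 < sin (2 * pi / real N)"
      using N3 by (intro sin_gt_zero) (simp_all add: field_simps)
    ultimately show False by simp
  qed
qed

lemma roots_unity_2: "roots_unity 2 = {1, -1}"
  by (auto simp: power2_eq_1_iff)

lemma ngon_sum_2: "ngon_sum 2 = 1 / 4"
proof -
  have "roots_unity 2 - {1} = {-1}" unfolding roots_unity_2 by auto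
  then show ?thesis by (simp add: ngon_sum_def)
qed

lemma ngon_sum_pos:
  assumes "2 \<le> N"
  shows "0 < ngon_sum N"
  unfolding ngon_sum_def
proof (rule sum_pos)
  have "card (roots_unity N - {1}) = N - 1"
    using assms card_roots_unity_eq[of N] finite_roots_unity[of N] by (simp add: card_Diff_singleton)
  then show "roots_unity N - {1} \<noteq> {}" using assms by fastforce
  show "finite (roots_unity N - {1})" using assms by (simp add: finite_roots_unity)
qed auto

lemma layer_sum_strict_antimono:
  assumes N: "2 \<le> N" and u: "cmod u = 1" and h: "0 < h" "h < h'"
  shows "layer_sum N h' u (\<lambda>z. 1 + Re z) < layer_sum N h u (\<lambda>z. 1 + Re z)"
proof -
  have N0: "0 < N" using N by simp
  have h2: "h\<^sup>2 < h'\<^sup>2" using h by (intro power_strict_mono) simp_all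
  have weight: "1 / sqrt (2 + h'\<^sup>2 - 2 * Re (w * u)) ^ 3 < 1 / sqrt (2 + h\<^sup>2 - 2 * Re (w * u)) ^ 3"
    if "w \<in> roots_unity N" for w
  proof (rule divide_strict_left_mono)
    have p: "0 < 2 + h\<^sup>2 - 2 * Re (w * u)" "0 < 2 + h'\<^sup>2 - 2 * Re (w * u)"
      using layer_radicand_pos[OF that N0 u] h by simp_all
    show "sqrt (2 + h\<^sup>2 - 2 * Re (w * u)) ^ 3 < sqrt (2 + h'\<^sup>2 - 2 * Re (w * u)) ^ 3"
      by (rule power_strict_mono) (use p h2 in simp_all)
    show "0 < sqrt (2 + h'\<^sup>2 - 2 * Re (w * u)) ^ 3 * sqrt (2 + h\<^sup>2 - 2 * Re (w * u)) ^ 3"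
      using p by simp
  qed simp
  have nonneg: "0 \<le> 1 + Re (w * u)" if "w \<in> roots_unity N" for w
    using cmod_1_mult[OF norm_root_unity[OF that N0] u] abs_Re_le_cmod[of "w * u"] by linarith
  show ?thesis unfolding layer_sum_def
  proof (rule sum_strict_mono_ex1)
    show "finite (roots_unity N)" using N0 by (simp add: finite_roots_unity)
    show "\<forall>w\<in>roots_unity N. (1 + Re (w * u)) / sqrt (2 + h'\<^sup>2 - 2 * Re (w * u)) ^ 3
        \<le> (1 + Re (w * u)) / sqrt (2 + h\<^sup>2 - 2 * Re (w * u)) ^ 3"
    proof
      fix w assume w: "w \<in> roots_unity N"
      show "(1 + Re (w * u)) / sqrt (2 + h'\<^sup>2 - 2 * Re (w * u)) ^ 3
        \<le> (1 + Re (w * u)) / sqrt (2 + h\<^sup>2 - 2 * Re (w * u)) ^ 3"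
        using mult_left_mono[OF less_imp_le[OF weight[OF w]] nonneg[OF w]]
        by (simp only: times_divide_eq_right mult_1_right)
    qed
    \<comment> \<open>A numerator may be 0, namely where \<open>w * u = -1\<close>, but their total
      \<open>N\<close> is positive. So one numerator is positive and makes the comparison
      strict.\<close>
    have "(\<Sum>w\<in>roots_unity N. 1 + Re (w * u)) = real N"
      unfolding sum.distrib sum_Re_roots_unity[OF N] using card_roots_unity_eq[OF N0] by simp
    then have "\<not> (\<forall>w\<in>roots_unity N. 1 + Re (w * u) \<le> 0)"
      using sum_nonpos[of "roots_unity N" "\<lambda>w. 1 + Re (w * u)"] N0 by fastforce
    then obtain w where w: "w \<in> roots_unity N" "0 < 1 + Re (w * u)" by fastforce
    show "\<exists>w\<in>roots_unity N. (1 + Re (w * u)) / sqrt (2 + h'\<^sup>2 - 2 * Re (w * u)) ^ 3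
        < (1 + Re (w * u)) / sqrt (2 + h\<^sup>2 - 2 * Re (w * u)) ^ 3"
      using mult_strict_left_mono[OF weight[OF w(1)] w(2)] w(1)
      by (intro bexI[of _ w]) (simp_all only: times_divide_eq_right mult_1_right)
  qed
qed

section \<open>Existence and uniqueness of the height for equal masses\<close>

lemma layer_sum_le:
  assumes N: "0 < N" and u: "cmod u = 1" and h: "0 < h"
  shows "layer_sum N h u (\<lambda>z. 1 + Re z) \<le> 2 * real N / h ^ 3"
proof -
  have "(1 + Re (w * u)) / sqrt (2 + h\<^sup>2 - 2 * Re (w * u)) ^ 3 \<le> 2 / h ^ 3"
    if "w \<in> roots_unity N" for w
  proof (rule frac_le)
    have R: "Re (w * u) \<le> 1" by (rule Re_le_1[OF cmod_1_mult[OF norm_root_unity[OF that N] u]])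
    then show "1 + Re (w * u) \<le> 2" by linarith
    have "h \<le> sqrt (2 + h\<^sup>2 - 2 * Re (w * u))" using R by (intro real_le_rsqrt) linarith
    then show "h ^ 3 \<le> sqrt (2 + h\<^sup>2 - 2 * Re (w * u)) ^ 3" using h by (intro power_mono) simp_all
  qed (use h in simp_all)
  then have "layer_sum N h u (\<lambda>z. 1 + Re z) \<le> (\<Sum>w\<in>roots_unity N. 2 / h ^ 3)"
    unfolding layer_sum_def by (intro sum_mono)
  also have "\<dots> = 2 * real N / h ^ 3" using card_roots_unity_eq[OF N] by simp
  finally show ?thesis .
qed

lemma layer_sum_eq_ngon_sum_exists:
  assumes N: "2 \<le> N" and u: "cmod u = 1" and h0: "0 \<le> h0"
    and pos: "\<And>w. w \<in> roots_unity N \<Longrightarrow> 0 < 2 + h0\<^sup>2 - 2 * Re (w * u)"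
    and gt: "ngon_sum N < layer_sum N h0 u (\<lambda>z. 1 + Re z)"
  shows "\<exists>h>0. layer_sum N h u (\<lambda>z. 1 + Re z) = ngon_sum N"
proof -
  have N0: "0 < N" using N by simp
  have "((\<lambda>h. 2 * real N / h ^ 3) \<longlongrightarrow> 0) at_top" by real_asymp
  then have "eventually (\<lambda>h. 2 * real N / h ^ 3 < ngon_sum N) at_top"
    using ngon_sum_pos[OF N] by (rule order_tendstoD)
  then have "eventually (\<lambda>h. 2 * real N / h ^ 3 < ngon_sum N \<and> h0 < h) at_top"
    using eventually_gt_at_top[of h0] by (rule eventually_conj)
  then obtain h1 where h1: "2 * real N / h1 ^ 3 < ngon_sum N" "h0 < h1"
    unfolding eventually_at_top_linorder by blast
  have le: "layer_sum N h1 u (\<lambda>z. 1 + Re z) \<le> ngon_sum N"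
    using layer_sum_le[OF N0 u, of h1] h1 h0 by linarith
  have "continuous_on {h0..h1} (\<lambda>h. layer_sum N h u (\<lambda>z. 1 + Re z))"
    unfolding layer_sum_def
  proof (intro continuous_on_sum continuous_on_divide continuous_intros ballI)
    fix w h assume w: "w \<in> roots_unity N" and "h \<in> {h0..h1}"
    then have "h0\<^sup>2 \<le> h\<^sup>2" using h0 by (intro power_mono) simp_all
    then have "0 < 2 + h\<^sup>2 - 2 * Re (w * u)" using pos[OF w] by linarith
    then show "sqrt (2 + h\<^sup>2 - 2 * Re (w * u)) ^ 3 \<noteq> 0" by (simp only: power_not_zero real_sqrt_eq_zero_cancel_iff) simp
  qed
  from IVT2'[OF le less_imp_le[OF gt] less_imp_le[OF h1(2)] this]
  obtain h where h: "h0 \<le> h" "layer_sum N h u (\<lambda>z. 1 + Re z) = ngon_sum N" by blast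
  \<comment> \<open>The strict inequality at \<open>h0\<close> rules out the endpoint, so the
    solution is positive even for \<open>h0 = 0\<close>.\<close>
  moreover have "h \<noteq> h0" using h(2) gt by fastforce
  ultimately show ?thesis using h0 by (intro exI[of _ h]) simp
qed

lemma layer_sum_ge_term:
  assumes N: "0 < N" and u: "cmod u = 1"
    and pos: "\<And>w. w \<in> roots_unity N \<Longrightarrow> 0 < 2 + h\<^sup>2 - 2 * Re (w * u)"
  shows "(1 + Re u) / sqrt (2 + h\<^sup>2 - 2 * Re u) ^ 3 \<le> layer_sum N h u (\<lambda>z. 1 + Re z)"
proof -
  have "0 \<le> (1 + Re (w * u)) / sqrt (2 + h\<^sup>2 - 2 * Re (w * u)) ^ 3" if "w \<in> roots_unity N" for w
  proof (rule divide_nonneg_nonneg)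
    show "0 \<le> 1 + Re (w * u)"
      using cmod_1_mult[OF norm_root_unity[OF that N] u] abs_Re_le_cmod[of "w * u"] by linarith
    show "0 \<le> sqrt (2 + h\<^sup>2 - 2 * Re (w * u)) ^ 3"
      by (intro zero_le_power real_sqrt_ge_zero less_imp_le pos that)
  qed
  then have "(1 + Re (1 * u)) / sqrt (2 + h\<^sup>2 - 2 * Re (1 * u)) ^ 3 \<le> layer_sum N h u (\<lambda>z. 1 + Re z)"
    unfolding layer_sum_def
    using member_le_sum[of 1 "roots_unity N"
        "\<lambda>w. (1 + Re (w * u)) / sqrt (2 + h\<^sup>2 - 2 * Re (w * u)) ^ 3"]
      finite_roots_unity[of N, where 'a = complex] N
    by (simp del: times_complex.sel)
  then show ?thesis by simp
qed

text \<open>Each of the \<open>N - 1\<close> chords from the vertex 1 is at least as long as the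
  side \<open>2 * sin (pi / N)\<close>.\<close>

lemma ngon_sum_le:
  assumes N: "2 \<le> N"
  shows "ngon_sum N \<le> (real N - 1) / (4 * sin (pi / real N))"
proof -
  have N0: "0 < N" using N by simp
  have s0: "0 < sin (pi / real N)" using N by (intro sin_gt_zero) (simp_all add: field_simps)
  have "1 / (2 * cmod (1 - w)) \<le> 1 / (4 * sin (pi / real N))" if w: "w \<in> roots_unity N - {1}" for w
  proof -
    obtain k where k: "k \<in> {1..N}" "w = cis (2 * real k * pi / real N)"
      using bij_betw_imp_surj_on[OF bij_betw_roots_unity_cis[OF N0]] w by blast
    have "k \<noteq> N" using k w N0 by auto
    then have k': "1 \<le> real k" "real k + 1 \<le> real N" using k(1) by auto
    define x where "x = real k * pi / real N"
    have xl: "pi / real N \<le> x" unfolding x_def using k' N0 by (simp add: divide_right_mono)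
    have "real k * pi \<le> (real N - 1) * pi" using k' by (intro mult_right_mono) simp_all
    then have "x \<le> (real N - 1) * pi / real N" unfolding x_def using N0 by (simp add: divide_right_mono)
    also have "\<dots> = pi - pi / real N" using N0 by (simp add: field_simps)
    finally have xu: "x \<le> pi - pi / real N" .
    have pN: "0 < pi / real N" using N0 by simp
    \<comment> \<open>The half angle \<open>x\<close> lies between \<open>pi / N\<close> and
      \<open>pi - pi / N\<close>; beyond \<open>pi / 2\<close> the sine is reflected.\<close>
    have "sin (pi / real N) \<le> sin x"
    proof (cases "x \<le> pi / 2")
      case True
      then show ?thesis using xl pN by (intro sin_monotone_2pi_le) linarith+
    next
      case False
      then have "sin (pi / real N) \<le> sin (pi - x)" using xu pN by (intro sin_monotone_2pi_le) linarith+
      then show ?thesis by simp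
    qed
    have w2: "w = cis (2 * x)" unfolding k x_def by (simp add: mult.assoc)
    have "(cmod (w - 1))\<^sup>2 = 2 - 2 * cos (2 * x)"
      unfolding w2 by (subst cmod_minus_1_square) simp_all
    also have "\<dots> = (2 * sin x)\<^sup>2" by (simp add: cos_double_sin power_mult_distrib)
    finally have "(cmod (1 - w))\<^sup>2 = (2 * sin x)\<^sup>2" by (simp only: norm_minus_commute)
    then have "cmod (1 - w) = 2 * sin x"
      by (rule power2_eq_imp_eq) (use s0 \<open>sin (pi / real N) \<le> sin x\<close> in simp_all)
    then show ?thesis using s0 \<open>sin (pi / real N) \<le> sin x\<close> by (intro divide_left_mono) simp_all
  qed
  then have "ngon_sum N \<le> (\<Sum>w\<in>roots_unity N - {1}. 1 / (4 * sin (pi / real N)))"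
    unfolding ngon_sum_def by (intro sum_mono)
  also have "\<dots> = real (card (roots_unity N - {1})) * (1 / (4 * sin (pi / real N)))" by simp
  also have "real (card (roots_unity N - {1})) = real N - 1"
    using N card_roots_unity_eq[OF N0] finite_roots_unity[of N] by (simp add: card_Diff_singleton of_nat_diff)
  finally show ?thesis by simp
qed

text \<open>The right side is the term \<open>w = 1\<close> at \<open>h = 0\<close> and
  \<open>\<theta> = pi / N\<close>. With \<open>s\<close> and \<open>c\<close> the sine and cosine
  of \<open>pi / (2 * N)\<close>, the shortest-chord bound reduces the claim to
  \<open>(N - 1) * s\<^sup>2 < 2 * c ^ 3\<close>.\<close>

lemma ngon_sum_less_layer_sum_0:
  assumes N: "2 \<le> N"
  shows "ngon_sum N < (1 + cos (pi / real N)) / sqrt (2 - 2 * cos (pi / real N)) ^ 3"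
proof -
  define x where "x = pi / (2 * real N)"
  define s where "s = sin x"
  define c where "c = cos x"
  have x2: "pi / real N = 2 * x" by (simp add: x_def)
  have N0: "0 < real N" using N by simp
  have x0: "0 < x" "x \<le> pi / 4" using N by (auto simp: x_def field_simps)
  have s: "0 < s" unfolding s_def using x0 pi_gt_zero by (intro sin_gt_zero) linarith+
  have c4: "sqrt 2 / 2 \<le> c"
    unfolding c_def cos_45[symmetric] using x0 pi_gt_zero by (intro cos_monotone_0_pi_le) linarith+
  have sx: "s \<le> x" unfolding s_def using x0 by (intro sin_x_le_x) simp
  have c0: "0 < c" using c4 by (rule less_le_trans[rotated]) simp
  have "(real N - 1) * s\<^sup>2 < 2 * c ^ 3"
  \<comment> \<open>For \<open>N\<close> at least 3 the number 1 separates the two sides. For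
    \<open>N = 2\<close> it does not, since there \<open>2 * c ^ 3 = c < 1\<close>, and the values
    are compared directly.\<close>
  proof (cases "N = 2")
    case True
    have "x = pi / 4" using True by (simp add: x_def)
    then have sc: "s = sqrt 2 / 2" "c = sqrt 2 / 2" by (simp_all only: s_def c_def sin_45 cos_45)
    have "s\<^sup>2 = 1 / 2" "c\<^sup>2 = 1 / 2" unfolding sc by (simp_all add: power_divide)
    moreover from this(2) have "2 * c ^ 3 = c" by (simp add: power3_eq_cube flip: power2_eq_square)
    moreover have "1 / 2 < c" using real_sqrt_gt_1_iff[of 2] unfolding sc by simp
    ultimately show ?thesis using True by simp
  next
    case False
    then have N3: "3 \<le> real N" using N by simp
    have "x \<le> pi / 6" using N3 unfolding x_def by (intro divide_left_mono) simp_all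
    then have c6: "sqrt 3 / 2 \<le> c"
      unfolding c_def cos_30[symmetric] using x0 pi_gt_zero by (intro cos_monotone_0_pi_le) linarith+
    have "8 / 5 \<le> sqrt (3::real)" by (intro real_le_rsqrt) (simp add: power2_eq_square)
    then have "4 / 5 \<le> c" using c6 by linarith
    then have "(4 / 5) ^ 3 \<le> c ^ 3" by (intro power_mono) simp_all
    then have c3: "1 < 2 * c ^ 3" by (simp add: power3_eq_cube)
    have "(real N - 1) * s\<^sup>2 \<le> (real N - 1) * x\<^sup>2"
      using sx s N3 by (intro mult_left_mono power_mono) simp_all
    also have "\<dots> = pi\<^sup>2 / 16 * (4 * (real N - 1) / (real N)\<^sup>2)"
    proof -
      have "k * x\<^sup>2 = pi\<^sup>2 / 16 * (4 * k / (real N)\<^sup>2)" for k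
        by (simp add: x_def power_divide power_mult_distrib)
      then show ?thesis .
    qed
    also have "\<dots> \<le> pi\<^sup>2 / 16 * 1"
    proof (rule mult_left_mono)
      have "0 \<le> (real N - 2)\<^sup>2" by simp
      then have "4 * (real N - 1) \<le> (real N)\<^sup>2" by (simp add: power2_eq_square algebra_simps)
      then show "4 * (real N - 1) / (real N)\<^sup>2 \<le> 1" using N0 by simp
    qed simp
    also have "pi\<^sup>2 / 16 * 1 \<le> 1"
      using power_mono[OF less_imp_le[OF pi_less_4], of 2] by simp
    finally show ?thesis using c3 by linarith
  qed
  \<comment> \<open>With the denominator \<open>8 * s ^ 3 * c\<close> the sides become the chord
    bound \<open>(N - 1) / (4 * sin (2 * x))\<close> and the term
    \<open>2 * c\<^sup>2 / (2 * s) ^ 3\<close>.\<close>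
  then have key: "(real N - 1) * s\<^sup>2 / (8 * s ^ 3 * c) < 2 * c ^ 3 / (8 * s ^ 3 * c)"
    using s c0 by (intro divide_strict_right_mono) simp_all
  have "ngon_sum N \<le> (real N - 1) / (4 * (2 * s * c))"
    using ngon_sum_le[OF N] unfolding x2 sin_double s_def[symmetric] c_def[symmetric] .
  also have "\<dots> = (real N - 1) * s\<^sup>2 / (8 * s ^ 3 * c)"
    using s by (simp add: power2_eq_square power3_eq_cube)
  also note key
  also have "2 * c ^ 3 / (8 * s ^ 3 * c) = 2 * c\<^sup>2 / (2 * s) ^ 3"
    using c0 by (simp add: power2_eq_square power3_eq_cube)
  also have "2 * c\<^sup>2 = 1 + cos (pi / real N)" unfolding x2 c_def cos_double_cos by simp
  also have "2 * s = sqrt (2 - 2 * cos (pi / real N))"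
  proof -
    have "2 - 2 * cos (pi / real N) = (2 * s)\<^sup>2"
      unfolding x2 s_def cos_double_sin by (simp add: power_mult_distrib)
    then show ?thesis using s by (simp only: real_sqrt_abs)
  qed
  finally show ?thesis .
qed

lemma layer_sum_eq_ngon_sum_ex1:
  assumes N: "2 \<le> N" and \<theta>: "\<theta> \<in> {0, pi / real N}"
  shows "\<exists>!h. 0 < h \<and> layer_sum N h (cis \<theta>) (\<lambda>z. 1 + Re z) = ngon_sum N"
proof -
  have N0: "0 < N" using N by simp
  have u: "cmod (cis \<theta>) = 1" by simp
  have "\<exists>h>0. layer_sum N h (cis \<theta>) (\<lambda>z. 1 + Re z) = ngon_sum N"
  proof (cases "\<theta> = 0")
    case True
    define P where "P = ngon_sum N"
    \<comment> \<open>For \<open>\<theta> = 0\<close> the term \<open>w = 1\<close> equals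
      \<open>2 / h0 ^ 3\<close>, which blows up at height 0. This height is small enough to make it
      exceed \<open>P\<close>.\<close>
    define h0 where "h0 = 1 / (P + 1)"
    have P: "0 < P" unfolding P_def by (rule ngon_sum_pos[OF N])
    have h0: "0 < h0" using P by (simp add: h0_def)
    have pos: "0 < 2 + h0\<^sup>2 - 2 * Re (w * cis \<theta>)" if "w \<in> roots_unity N" for w
      by (rule layer_radicand_pos[OF that N0 u h0])
    have "P + 1 \<le> (P + 1) ^ 3" using P by (intro self_le_power) simp_all
    then have "P < 2 * (P + 1) ^ 3" using P by linarith
    also have "\<dots> = 2 / h0 ^ 3" by (simp add: h0_def power_divide)
    also have "\<dots> = (1 + Re (cis \<theta>)) / sqrt (2 + h0\<^sup>2 - 2 * Re (cis \<theta>)) ^ 3"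
      using True h0 by simp
    also have "\<dots> \<le> layer_sum N h0 (cis \<theta>) (\<lambda>z. 1 + Re z)"
      by (rule layer_sum_ge_term[OF N0 u pos])
    finally show ?thesis
      using layer_sum_eq_ngon_sum_exists[OF N u less_imp_le[OF h0] pos] unfolding P_def by blast
  next
    case False
    then have t: "\<theta> = pi / real N" using \<theta> by simp
    have pos: "0 < 2 + 0\<^sup>2 - 2 * Re (w * cis \<theta>)" if w: "w \<in> roots_unity N" for w
    proof -
      let ?z = "w * cis \<theta>"
      have z: "cmod ?z = 1" by (rule cmod_1_mult[OF norm_root_unity[OF w N0] u])
      \<comment> \<open>Half a step of twist keeps every \<open>w * u\<close> away from 1, so the
        comparison can be made at height 0.\<close>
      have "?z ^ N = -1" using w N0 by (simp add: t power_mult_distrib Complex.DeMoivre)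
      then have "?z \<noteq> 1" by force
      then have "0 < (cmod (?z - 1))\<^sup>2" by simp
      then show ?thesis unfolding cmod_minus_1_square[OF z] by (simp only: zero_power2 add_0_right)
    qed
    have "ngon_sum N < (1 + Re (cis \<theta>)) / sqrt (2 + 0\<^sup>2 - 2 * Re (cis \<theta>)) ^ 3"
      using ngon_sum_less_layer_sum_0[OF N] by (simp add: t)
    also have "\<dots> \<le> layer_sum N 0 (cis \<theta>) (\<lambda>z. 1 + Re z)"
      by (rule layer_sum_ge_term[OF N0 u pos])
    finally show ?thesis
      using layer_sum_eq_ngon_sum_exists[OF N u order_refl pos] by blast
  qed
  then obtain h where h: "0 < h" "layer_sum N h (cis \<theta>) (\<lambda>z. 1 + Re z) = ngon_sum N" by blast
  have "h' = h" if "0 < h'" "layer_sum N h' (cis \<theta>) (\<lambda>z. 1 + Re z) = ngon_sum N" for h'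
    using layer_sum_strict_antimono[OF N u that(1), of h] layer_sum_strict_antimono[OF N u h(1), of h']
      that(2) h(2) by (cases h h' rule: linorder_cases) simp_all
  then show ?thesis using h by blast
qed

section \<open>Conditions on the twist and the mass ratio\<close>

lemma sgn_layer_sum_Im:
  assumes "0 < N" "0 < h" "cmod u = 1"
  shows "sgn (layer_sum N h u Im) = sgn (Im (u ^ N))"
  unfolding layer_sum_def using assms by (intro sgn_sum_Im_roots_unity) simp_all

text \<open>All distances between the layers equal \<open>sqrt (2 + h\<^sup>2)\<close>, and the
  equation makes them equal to 2, the distance within a layer. This is the regular
  tetrahedron.\<close>

lemma layer_sum_1_2:
  assumes u: "cmod u = 1" "Re u = 0" and h: "0 < h" and eq: "layer_sum 2 h u (\<lambda>_. 1) = 1 / 4"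
  shows "h = sqrt 2"
proof -
  have p: "0 < sqrt (2 + h\<^sup>2)" by (simp add: add_pos_nonneg)
  have "2 / sqrt (2 + h\<^sup>2) ^ 3 = 1 / 4"
    using eq u(2) unfolding layer_sum_def roots_unity_2 by simp
  then have "sqrt (2 + h\<^sup>2) ^ 3 = 2 ^ 3" using p by (simp add: field_simps)
  then have "sqrt (2 + h\<^sup>2) = 2" by (rule power_eq_imp_eq_base) (use p in simp_all)
  then have "2 + h\<^sup>2 = 2\<^sup>2" using real_sqrt_pow2[of "2 + h\<^sup>2"] by simp
  then have "h\<^sup>2 = 2" by simp
  then show ?thesis using h by (metis abs_of_pos real_sqrt_abs)
qed

lemma two_ngons_central_imp:
  assumes N: "2 \<le> N" and b: "0 < b" and m: "0 < m" and h: "0 < h"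
    and \<theta>: "0 \<le> \<theta>" "\<theta> < 2 * pi / real N"
    and central: "two_ngons_central N 1 b m h \<theta>"
  shows "\<theta> \<in> {0, pi / real N}"
    and "b = 1 \<or> N = 2 \<and> h = sqrt 2 \<and> \<theta> = pi / 2"
proof -
  define u where "u = cis \<theta>"
  define T where "T = layer_sum N h u Re"
  define S where "S = layer_sum N h u (\<lambda>_. 1)"
  have N0: "0 < N" using N by simp
  have u: "cmod u = 1" by (simp add: u_def)
  have eqs: "layer_sum N h u Im = 0" "ngon_sum N = S + b * T" "b * ngon_sum N = b * S + T"
    using central two_ngons_central_iff[OF N b m h, of \<theta>] unfolding u_def S_def T_def by blast+
  have "sgn (Im (u ^ N)) = 0" using sgn_layer_sum_Im[OF N0 h u] eqs(1) by simp
  then have "sin (real N * \<theta>) = 0" by (simp add: u_def Complex.DeMoivre sgn_zero_iff)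
  moreover have N\<theta>: "0 \<le> real N * \<theta>" "real N * \<theta> < 2 * pi"
    using \<theta> N0 by (simp_all add: field_simps)
  ultimately have "real N * \<theta> = 0 \<or> real N * \<theta> = pi"
    using sin_gt_zero[of "real N * \<theta>"] sin_lt_zero[of "real N * \<theta>"] by linarith
  then show "\<theta> \<in> {0, pi / real N}" using N0 by (auto simp: field_simps)
  show "b = 1 \<or> N = 2 \<and> h = sqrt 2 \<and> \<theta> = pi / 2"
  proof (cases "T = 0")
    case False
    \<comment> \<open>Eliminating the polygon sum from the two radial equations leaves
      \<open>(b\<^sup>2 - 1) * T = 0\<close>.\<close>
    have "b * (S + b * T) = b * S + T" using eqs(2,3) by simp
    then have "(b * b - 1) * T = 0" by (simp add: algebra_simps)
    then have "(b - 1) * (b + 1) = 0" using False by (simp add: algebra_simps)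
    then show ?thesis using b by simp
  next
    case True
    have Re0: "Re (w * u) = 0" if "w \<in> roots_unity N" for w
      by (rule layer_sum_Re_eq_0[OF N u h True[unfolded T_def] that])
    have N2: "N = 2" and Re_u: "Re u = 0" by (rule roots_unity_Re_0[OF N u Re0], assumption)+
    have "\<theta> = pi / 2"
      using \<open>\<theta> \<in> {0, pi / real N}\<close> Re_u by (auto simp: N2 u_def)
    moreover have "h = sqrt 2"
      using layer_sum_1_2[OF u Re_u h] eqs(2) True unfolding S_def N2 ngon_sum_2 by simp
    ultimately show ?thesis using N2 by simp
  qed
qed

text \<open>At these angles \<open>u ^ N\<close> is real, so the tangential condition holds, and for
  \<open>b = 1\<close> the two radial conditions coincide.\<close>

lemma two_ngons_central_iff_equal_masses:
  assumes N: "2 \<le> N" and m: "0 < m" and h: "0 < h" and \<theta>: "\<theta> \<in> {0, pi / real N}"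
  shows "two_ngons_central N 1 1 m h \<theta> \<longleftrightarrow>
    layer_sum N h (cis \<theta>) (\<lambda>z. 1 + Re z) = ngon_sum N"
proof -
  have N0: "0 < N" using N by simp
  have "Im (cis \<theta> ^ N) = 0" using \<theta> N0 by (auto simp: Complex.DeMoivre)
  then have "layer_sum N h (cis \<theta>) Im = 0"
    using sgn_layer_sum_Im[OF N0 h, of "cis \<theta>"] by (simp add: sgn_zero_iff)
  then show ?thesis
    unfolding two_ngons_central_iff[OF N zero_less_one m h] layer_sum_add by auto
qed

text \<open>The tetrahedron is central for every \<open>b\<close>, so the claim \<open>b = 1\<close>
  must except it. The final count is of pairs of height and angle, hence the tetrahedron counts once
  whatever its mass ratio.\<close>

theorem corollary1p11:
  fixes N :: nat and m :: real
  assumes "N \<ge> 2" and "m > 0"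
  shows "(\<forall>b h \<theta> :: real. b > 0 \<and> h > 0 \<and> 0 \<le> \<theta> \<and> \<theta> < 2 * pi / real N \<and>
            two_ngons_central N 1 b m h \<theta> \<and>
            \<not> (N = 2 \<and> h = sqrt 2 \<and> \<theta> = pi / 2)
            \<longrightarrow> b = 1 \<and> \<theta> \<in> {0, pi / real N}) \<and>
         (\<forall>\<theta> \<in> {0, pi / real N}. \<exists>!h. h > 0 \<and> two_ngons_central N 1 1 m h \<theta>) \<and>
         card {(h, \<theta>). h > 0 \<and> 0 \<le> \<theta> \<and> \<theta> < 2 * pi / real N \<and>
                       (\<exists>b > 0. two_ngons_central N 1 b m h \<theta>)} = 2"
proof (intro conjI)
  show "\<forall>b h \<theta> :: real. b > 0 \<and> h > 0 \<and> 0 \<le> \<theta> \<and> \<theta> < 2 * pi / real N \<and>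
            two_ngons_central N 1 b m h \<theta> \<and>
            \<not> (N = 2 \<and> h = sqrt 2 \<and> \<theta> = pi / 2)
            \<longrightarrow> b = 1 \<and> \<theta> \<in> {0, pi / real N}"
    using two_ngons_central_imp[OF assms(1) _ assms(2)] by blast
  show ex1: "\<forall>\<theta> \<in> {0, pi / real N}. \<exists>!h. h > 0 \<and> two_ngons_central N 1 1 m h \<theta>"
  proof
    fix \<theta> assume \<theta>: "\<theta> \<in> {0, pi / real N}"
    have "(\<lambda>h. h > 0 \<and> two_ngons_central N 1 1 m h \<theta>)
        = (\<lambda>h. 0 < h \<and> layer_sum N h (cis \<theta>) (\<lambda>z. 1 + Re z) = ngon_sum N)"
      using two_ngons_central_iff_equal_masses[OF assms _ \<theta>] by blast
    then show "\<exists>!h. h > 0 \<and> two_ngons_central N 1 1 m h \<theta>"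
      using layer_sum_eq_ngon_sum_ex1[OF assms(1) \<theta>] by (simp only:)
  qed
  then obtain H where H: "\<And>\<theta> h. \<theta> \<in> {0, pi / real N} \<Longrightarrow>
      h > 0 \<and> two_ngons_central N 1 1 m h \<theta> \<longleftrightarrow> h = H \<theta>"
    by metis
  let ?C = "{(h, \<theta>). h > 0 \<and> 0 \<le> \<theta> \<and> \<theta> < 2 * pi / real N \<and>
      (\<exists>b > 0. two_ngons_central N 1 b m h \<theta>)}"
  have range: "0 \<le> \<theta> \<and> \<theta> < 2 * pi / real N" if "\<theta> \<in> {0, pi / real N}" for \<theta>
    using that assms(1) by (auto simp: divide_strict_right_mono)
  have mem: "(h, \<theta>) \<in> ?C \<longleftrightarrow> \<theta> \<in> {0, pi / real N} \<and> h = H \<theta>" for h \<theta>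
  proof
    assume "(h, \<theta>) \<in> ?C"
    then obtain b where h: "h > 0" and \<theta>: "0 \<le> \<theta>" "\<theta> < 2 * pi / real N" and b: "b > 0"
      and c: "two_ngons_central N 1 b m h \<theta>" by blast
    note imp = two_ngons_central_imp[OF assms(1) b assms(2) h \<theta> c]
    \<comment> \<open>Each pair in the set is already realised with equal masses: either
      \<open>b = 1\<close>, or the shape is the tetrahedron, where \<open>b\<close> may be replaced
      by 1.\<close>
    have "two_ngons_central N 1 1 m h \<theta>"
      using imp(2)
    proof (elim disjE conjE)
      assume "b = 1"
      then show ?thesis using c by (simp only:)
    next
      assume "N = 2" "h = sqrt 2" "\<theta> = pi / 2"
      then show ?thesis
        using two_ngons_central_tetrahedron[OF zero_less_one assms(2)] by (simp only:)
    qed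
    then show "\<theta> \<in> {0, pi / real N} \<and> h = H \<theta>" using imp(1) H h by blast
  next
    assume "\<theta> \<in> {0, pi / real N} \<and> h = H \<theta>"
    then show "(h, \<theta>) \<in> ?C" using range H zero_less_one by blast
  qed
  have "?C = (\<lambda>\<theta>. (H \<theta>, \<theta>)) ` {0, pi / real N}"
  proof (rule set_eqI)
    fix p :: "real \<times> real"
    obtain h \<theta> where p: "p = (h, \<theta>)" by (cases p)
    show "p \<in> ?C \<longleftrightarrow> p \<in> (\<lambda>\<theta>. (H \<theta>, \<theta>)) ` {0, pi / real N}"
      unfolding p mem by blast
  qed
  moreover have "card ((\<lambda>\<theta>. (H \<theta>, \<theta>)) ` {0, pi / real N}) = card {0, pi / real N}"
    by (rule card_image) (simp add: inj_on_def)
  moreover have "card {0, pi / real N} = 2" using assms(1) by simp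
  ultimately show "card ?C = 2" by (simp only:)
qed

end
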